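(* Let $d\ge1$ be an integer and $s\ge\frac d2$ real. There exists a constant $C_{d,s}>0$, depending only on $d$ and $s$, such that for every $E\le0$ and every measurable $v:\mathbb{R}^d\to[0,\infty)$ for which the relevant right-hand side below is finite, $$\big\|K^\perp_{E,<1}\big\|_{\mathcal{L}^1}\le C_{d,s}\begin{cases}\big\|\langle x\rangle^{s-\frac d2}\sqrt{1+\ln\langle x\rangle}\,v\big\|_{L^2}^2 & \text{if } s-\frac d2\in\mathbb{N}_0,\\[4pt] \big\|\langle x\rangle^{s-\frac d2}\,v\big\|_{L^2}^2 & \text{if } s-\frac d2\notin\mathbb{N}_0.\end{cases}$$
   Context: $\mathbb{N}_0=\{0,1,2,\dots\}$, $\langle x\rangle=\sqrt{1+|x|^2}$, $L^2=L^2(\mathbb{R}^d)$, and $\|\cdot\|_{\mathcal{L}^1}$ is the trace norm on operators on $L^2(\mathbb{R}^d)$. Set $n=\lfloor s-\frac d2\rfloor$ and $\mathcal{F}_n:=\mathrm{span}\{x^\alpha v\mid\alpha\in\mathbb{N}_0^d,\ |\alpha|\le n\}$, where $x^\alpha=\prod_j x_j^{\alpha_j}$ and $|\alpha|=\sum_j\alpha_j$; under the finiteness assumption on the right-hand side, $\mathcal{F}_n$ is a finite-dimensional subspace of $L^2$. Let $\Pi_{\mathcal{F}_n}^\perp$ be the orthogonal projection of $L^2$ onto $\mathcal{F}_n^\perp$. The low-frequencies part of the Birman–Schwinger operator is $$K_{E,<1}:=v(x)\big((-\Delta)^s-E\big)^{-1}\mathds{1}_{|-i\nabla|<1}\,v(x),\qquad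 K_{E,<1}^\perp:=\Pi_{\mathcal{F}_n}^\perp K_{E,<1}\Pi_{\mathcal{F}_n}^\perp,$$ where $v(x)$ denotes multiplication by $v$, and $\mathds{1}_{|-i\nabla|<1}$ is the Fourier multiplier by the indicator function of $\{|\xi|<1\}$. The operator $K_{E,<1}^\perp$ is understood as the non-negative operator with quadratic form $$\langle u,K_{E,<1}^\perp u\rangle=\int_{|\xi|<1}\frac{\big|\mathcal{F}(v\,\Pi_{\mathcal{F}_n}^\perp u)(\xi)\big|^2}{|\xi|^{2s}-E}\,\mathrm{d}\xi,\qquad u\in L^2,$$ with $\mathcal{F}(f)(\xi)=(2\pi)^{-d/2}\int_{\mathbb{R}^d} e^{-ix\cdot\xi}f(x)\,\mathrm{d}x$. *)

theory Defs
  imports "HOL-Analysis.Analysis"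
begin

section \<open>The Hilbert space \<open>L\<^sup>2(\<real>\<^sup>d; \<complex>)\<close>\<close>

text \<open>
  Elements of \<open>L\<^sup>2\<close> are represented by square-integrable functions. Nothing below
  depends on the choice of representatives modulo equality almost everywhere.
  The inner product is conjugate-linear in the first argument.
\<close>

definition L2_space :: "(real^'d \<Rightarrow> complex) set" where
  "L2_space = {f. f \<in> borel_measurable lebesgue \<and> integrable lebesgue (\<lambda>x. (cmod (f x))\<^sup>2)}"

definition l2_inner :: "(real^'d \<Rightarrow> complex) \<Rightarrow> (real^'d \<Rightarrow> complex) \<Rightarrow> complex" where
  "l2_inner f g = (LINT x|lebesgue. cnj (f x) * g x)"

definition l2_norm :: "(real^'d \<Rightarrow> complex) \<Rightarrow> real" where
  "l2_norm f = sqrt (LINT x|lebesgue. (cmod (f x))\<^sup>2)"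

definition orth_compl :: "(real^'d \<Rightarrow> complex) set \<Rightarrow> (real^'d \<Rightarrow> complex) set" where
  "orth_compl M = {w \<in> L2_space. \<forall>f\<in>M. l2_inner f w = 0}"

text \<open>
  For a closed subspace \<open>N\<close>, the orthogonal projection of \<open>u\<close> onto \<open>N\<close> is the element
  \<open>w \<in> N\<close> with \<open>u - w \<bottom> N\<close>; it is unique up to equality almost everywhere.
\<close>

definition orth_proj ::
  "(real^'d \<Rightarrow> complex) set \<Rightarrow> (real^'d \<Rightarrow> complex) \<Rightarrow> (real^'d \<Rightarrow> complex)" where
  "orth_proj N u = (SOME w. w \<in> N \<and> (\<forall>z\<in>N. l2_inner z (\<lambda>x. u x - w x) = 0))"

definition orthonormal_basis :: "(nat \<Rightarrow> real^'d \<Rightarrow> complex) \<Rightarrow> bool" where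
  "orthonormal_basis e \<longleftrightarrow>
     (\<forall>n. e n \<in> L2_space) \<and>
     (\<forall>m n. l2_inner (e m) (e n) = (if m = n then 1 else 0)) \<and>
     (\<forall>f\<in>L2_space. (\<forall>n. l2_inner (e n) f = 0) \<longrightarrow> (AE x in lebesgue. f x = 0))"


section \<open>Operators and the trace norm\<close>

text \<open>
  Linearity holds modulo null sets. Together with boundedness it implies that \<open>T\<close>
  respects equality almost everywhere, so \<open>T\<close> is a bounded operator on the quotient space.
\<close>

definition bounded_op :: "((real^'d \<Rightarrow> complex) \<Rightarrow> (real^'d \<Rightarrow> complex)) \<Rightarrow> bool" where
  "bounded_op T \<longleftrightarrow>
     (\<forall>f\<in>L2_space. T f \<in> L2_space) \<and>
     (\<forall>f\<in>L2_space. \<forall>g\<in>L2_space. \<forall>a b.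
        AE x in lebesgue. T (\<lambda>y. a * f y + b * g y) x = a * T f x + b * T g x) \<and>
     (\<exists>M. \<forall>f\<in>L2_space. l2_norm (T f) \<le> M * l2_norm f)"

definition nonneg_op :: "((real^'d \<Rightarrow> complex) \<Rightarrow> (real^'d \<Rightarrow> complex)) \<Rightarrow> bool" where
  "nonneg_op T \<longleftrightarrow> bounded_op T \<and> (\<forall>f\<in>L2_space. l2_inner f (T f) \<in> \<real>\<^sub>\<ge>\<^sub>0)"

text \<open>
  \<open>|T| = (T\<^sup>* T)\<^sup>1\<^sup>/\<^sup>2\<close>: the non-negative operator \<open>P\<close> with \<open>P\<^sup>2 = T\<^sup>* T\<close>, the latter written
  through matrix elements. It is unique modulo null sets.
\<close>

definition op_abs ::
  "((real^'d \<Rightarrow> complex) \<Rightarrow> (real^'d \<Rightarrow> complex)) \<Rightarrow> (real^'d \<Rightarrow> complex) \<Rightarrow> (real^'d \<Rightarrow> complex)"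
  where
  "op_abs T = (SOME P. nonneg_op P \<and>
     (\<forall>f\<in>L2_space. \<forall>g\<in>L2_space. l2_inner f (P (P g)) = l2_inner (T f) (T g)))"

text \<open>
  \<open>\<parallel>T\<parallel> = Tr |T| = \<Sum>\<^sub>n \<langle>e\<^sub>n, |T| e\<^sub>n\<rangle>\<close>, with values in \<open>[0,\<infinity>]\<close>. The sum is the same for
  every orthonormal basis \<open>e\<close> of the (separable, infinite-dimensional) space \<open>L\<^sup>2\<close>;
  the supremum only avoids singling out one of them.
\<close>

definition trace_norm :: "((real^'d \<Rightarrow> complex) \<Rightarrow> (real^'d \<Rightarrow> complex)) \<Rightarrow> ennreal" where
  "trace_norm T = (SUP e\<in>Collect orthonormal_basis.
     (\<Sum>n. ennreal (Re (l2_inner (e n) (op_abs T (e n))))))"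


section \<open>The low-frequency part of the Birman--Schwinger operator\<close>

definition japanese_bracket :: "real^'d \<Rightarrow> real" where
  "japanese_bracket x = sqrt (1 + (norm x)\<^sup>2)"

definition fourier :: "(real^'d \<Rightarrow> complex) \<Rightarrow> real^'d \<Rightarrow> complex" where
  "fourier f \<xi> = complex_of_real ((2 * pi) powr (- (real CARD('d) / 2))) *
     (LINT x|lebesgue. cis (- (x \<bullet> \<xi>)) * f x)"

definition multi_monom :: "('d::finite \<Rightarrow> nat) \<Rightarrow> real^'d \<Rightarrow> real" where
  "multi_monom \<alpha> x = (\<Prod>j\<in>UNIV. (x $ j) ^ \<alpha> j)"

text \<open>
  The complex span \<open>\<F>\<^sub>n\<close> of the functions \<open>x\<^sup>\<alpha> v\<close> with \<open>|\<alpha>| \<le> n = \<lfloor>s - d/2\<rfloor>\<close>. The index set is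
  finite, so its linear combinations are exactly the sums over the whole index set.
\<close>

definition moment_space :: "real \<Rightarrow> (real^'d \<Rightarrow> real) \<Rightarrow> (real^'d \<Rightarrow> complex) set" where
  "moment_space s v =
     {\<lambda>x. \<Sum>\<alpha> | (\<Sum>j\<in>UNIV. \<alpha> j) \<le> nat \<lfloor>s - real CARD('d) / 2\<rfloor>.
        c \<alpha> * complex_of_real (multi_monom \<alpha> x * v x) | c :: ('d \<Rightarrow> nat) \<Rightarrow> complex. True}"

text \<open>
  The quadratic form \<open>w \<mapsto> \<langle>w, K\<^bsub>E,<1\<^esub> w\<rangle>\<close> with values in \<open>[0,\<infinity>]\<close>. For \<open>E = 0\<close> it can
  take the value \<open>\<infinity>\<close>; the point \<open>\<xi> = 0\<close>, where the denominator then vanishes, is a null set.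
\<close>

definition bs_low_form :: "real \<Rightarrow> (real^'d \<Rightarrow> real) \<Rightarrow> real \<Rightarrow> (real^'d \<Rightarrow> complex) \<Rightarrow> ennreal" where
  "bs_low_form s v E w =
     (\<integral>\<^sup>+\<xi>\<in>ball 0 1. ennreal ((cmod (fourier (\<lambda>x. complex_of_real (v x) * w x) \<xi>))\<^sup>2
        / (norm \<xi> powr (2 * s) - E)) \<partial>lebesgue)"

text \<open>
  \<open>K\<close> is the operator \<open>K\<^bsub>E,<1\<^esub>\<^sup>\<bottom> = \<Pi>\<^sup>\<bottom> K\<^bsub>E,<1\<^esub> \<Pi>\<^sup>\<bottom>\<close>. Since \<open>L\<^sup>2\<close> is complex, the quadratic form
  determines \<open>K\<close> modulo null sets.
\<close>

definition is_bs_low_perp ::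
  "real \<Rightarrow> (real^'d \<Rightarrow> real) \<Rightarrow> real \<Rightarrow> ((real^'d \<Rightarrow> complex) \<Rightarrow> (real^'d \<Rightarrow> complex)) \<Rightarrow> bool" where
  "is_bs_low_perp s v E K \<longleftrightarrow> nonneg_op K \<and>
     (\<forall>u\<in>L2_space. ennreal (Re (l2_inner u (K u)))
        = bs_low_form s v E (orth_proj (orth_compl (moment_space s v)) u))"

text \<open>The weight multiplying \<open>v\<close> in the bound.\<close>

definition bs_weight :: "real \<Rightarrow> real^'d \<Rightarrow> real" where
  "bs_weight s x =
     (if s - real CARD('d) / 2 \<in> \<nat>
      then japanese_bracket x powr (s - real CARD('d) / 2) * sqrt (1 + ln (japanese_bracket x))
      else japanese_bracket x powr (s - real CARD('d) / 2))"

end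

theory Submission
  imports Defs "HOL-Probability.Characteristic_Functions"
begin

text \<open>
  With \<open>g\<^sub>\<xi>(x) = e\<^bsup>i x \<bullet> \<xi>\<^esup> v(x)\<close> one has \<open>\<F>(v \<Pi>\<^sup>\<bottom> u)(\<xi>) = (2\<pi>)\<^bsup>-d/2\<^esup> \<langle>\<Pi>\<^sup>\<bottom> g\<^sub>\<xi>, u\<rangle>\<close>, so the
  operator is the superposition of the rank-one operators \<open>|\<Pi>\<^sup>\<bottom> g\<^sub>\<xi>\<rangle>\<langle>\<Pi>\<^sup>\<bottom> g\<^sub>\<xi>|\<close> with weight
  \<open>(2\<pi>)\<^bsup>-d\<^esup> / (|\<xi>|\<^bsup>2s\<^esup> - E)\<close> over \<open>|\<xi>| < 1\<close>, and its trace is the weighted integral of \<open>\<parallel>\<Pi>\<^sup>\<bottom> g\<^sub>\<xi>\<parallel>\<^sup>2\<close>.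
  Subtracting from \<open>e\<^bsup>i x \<bullet> \<xi>\<^esup>\<close> its Taylor polynomial of degree \<open>n\<close> changes \<open>g\<^sub>\<xi>\<close> by an element of
  the moment space, hence
  \<open>\<parallel>\<Pi>\<^sup>\<bottom> g\<^sub>\<xi>\<parallel>\<^sup>2 \<le> 4 \<integral> (|x||\<xi>|)\<^bsup>2n\<^esup> min(1, |x|\<^sup>2|\<xi>|\<^sup>2) v(x)\<^sup>2 dx\<close>. Integrating first in \<open>\<xi>\<close>, over dyadic
  shells, gives a geometric sum of size \<open>\<langle>x\<rangle>\<^bsup>2s-d\<^esup>\<close>, or, if \<open>2s - d = 2n\<close>, a constant term for each
  of the about \<open>log \<langle>x\<rangle>\<close> shells with \<open>|x||\<xi>| \<ge> 1\<close>.
\<close>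

section \<open>Square-integrable functions and non-negative operators\<close>

text \<open>Two choice terms shape the proof. \<open>trace_norm\<close> is taken of
  \<open>op_abs K\<close>; the passage back to K is the uniqueness of the non-negative square root,
  proved by an elementary iteration, with K itself as a witness for the choice. After that the trace
  involves only the diagonal elements <e, K e>, which the quadratic form prescribes, so the bound
  reaches every K with this form, and Bessel's inequality in each frequency slice controls the sum.
  The other choice term, \<open>orth_proj\<close>, shows no dependence on the frequency.
  Gram-Schmidt on the monomials times \<open>v\<close> gives an explicit finite-rank projection, and
  with it the joint measurability that Tonelli demands; the same kernel then builds an operator,
  which settles existence. E enters through |\<xi>|^(2s) - E \<ge> |\<xi>|^(2s), so the constant is
  uniform in E. The two halves of the minimum serve the two sides of |\<xi>| = 1/<x>: the square
  gives decay towards \<xi> = 0 because s - d/2 < n + 1, and the 1 keeps the outer shells below the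
  power <x>^(2s-d), up to the logarithm, because n \<le> s - d/2.\<close>

lemma sigma_finite_lebesgue: "sigma_finite_measure (lebesgue :: 'a::euclidean_space measure)"
proof
  obtain A :: "'a set set" where "countable A" "A \<subseteq> sets lborel" "\<Union>A = space lborel"
    "\<forall>a\<in>A. emeasure lborel a \<noteq> \<infinity>"
    using lborel.sigma_finite_countable by blast
  \<comment> \<open>Completion keeps the measure of Borel sets, so a countable cover for
    \<open>lborel\<close> serves for \<open>lebesgue\<close>.\<close>
  then show "\<exists>A::'a set set. countable A \<and> A \<subseteq> sets lebesgue \<and> \<Union>A = space lebesgue \<and>
      (\<forall>a\<in>A. emeasure lebesgue a \<noteq> \<infinity>)"
    by (intro exI[of _ A]) (auto simp: emeasure_completion subset_eq)
qed

interpretation leb: sigma_finite_measure "lebesgue :: 'a::euclidean_space measure"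
  by (rule sigma_finite_lebesgue)

interpretation leb_pair: pair_sigma_finite
  "lebesgue :: 'a::euclidean_space measure" "lebesgue :: 'b::euclidean_space measure"
  by (simp add: pair_sigma_finite_def sigma_finite_lebesgue)

lemma borel_measurable_cnj [measurable]:
  assumes [measurable]: "f \<in> borel_measurable M"
  shows "(\<lambda>x. cnj (f x)) \<in> borel_measurable M"
  by (rule borel_measurable_continuous_on[OF _ assms]) (intro continuous_intros)

lemma L2_measurable: "f \<in> L2_space \<Longrightarrow> f \<in> borel_measurable lebesgue"
  by (simp add: L2_space_def)

lemma L2_integrable: "f \<in> L2_space \<Longrightarrow> integrable lebesgue (\<lambda>x. (cmod (f x))\<^sup>2)"
  by (simp add: L2_space_def)

lemma L2_iff_nn_integral:
  "f \<in> L2_space \<longleftrightarrow>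
    f \<in> borel_measurable lebesgue \<and> (\<integral>\<^sup>+x. ennreal ((cmod (f x))\<^sup>2) \<partial>lebesgue) < \<infinity>"
  by (auto simp: L2_space_def integrable_iff_bounded)

lemma L2_bound:
  assumes [measurable]: "f \<in> borel_measurable lebesgue"
    and "integrable lebesgue g" "\<And>x. (cmod (f x))\<^sup>2 \<le> g x"
  shows "f \<in> L2_space"
proof -
  have "integrable lebesgue (\<lambda>x. (cmod (f x))\<^sup>2)"
    by (rule Bochner_Integration.integrable_bound[OF assms(2)])
      (auto intro!: AE_I2 order_trans[OF assms(3) abs_ge_self])
  then show ?thesis by (simp add: L2_space_def)
qed

lemma L2_lin:
  assumes "f \<in> L2_space" "g \<in> L2_space"
  shows "(\<lambda>x. a * f x + b * g x) \<in> L2_space"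
proof (rule L2_bound)
  note [measurable] = assms[THEN L2_measurable]
  show "(\<lambda>x. a * f x + b * g x) \<in> borel_measurable lebesgue"
    by measurable
  show "integrable lebesgue (\<lambda>x. 2 * (cmod a)\<^sup>2 * (cmod (f x))\<^sup>2 + 2 * (cmod b)\<^sup>2 * (cmod (g x))\<^sup>2)"
    by (intro Bochner_Integration.integrable_add integrable_mult_right assms L2_integrable)
  fix x
  have "cmod (a * f x + b * g x) \<le> cmod a * cmod (f x) + cmod b * cmod (g x)"
    by (metis norm_triangle_ineq norm_mult)
  then have "(cmod (a * f x + b * g x))\<^sup>2 \<le> (cmod a * cmod (f x) + cmod b * cmod (g x))\<^sup>2"
    by (simp add: power_mono)
  also have "\<dots> \<le> 2 * (cmod a * cmod (f x))\<^sup>2 + 2 * (cmod b * cmod (g x))\<^sup>2"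
    using sum_squares_bound[of "cmod a * cmod (f x)" "cmod b * cmod (g x)"]
    by (simp only: power2_sum)
  finally show "(cmod (a * f x + b * g x))\<^sup>2
      \<le> 2 * (cmod a)\<^sup>2 * (cmod (f x))\<^sup>2 + 2 * (cmod b)\<^sup>2 * (cmod (g x))\<^sup>2"
    by (simp add: power_mult_distrib mult.assoc)
qed

lemma L2_cmult: "f \<in> L2_space \<Longrightarrow> (\<lambda>x. a * f x) \<in> L2_space"
  using L2_lin[of f f a 0] by simp

lemma L2_diff: "f \<in> L2_space \<Longrightarrow> g \<in> L2_space \<Longrightarrow> (\<lambda>x. f x - g x) \<in> L2_space"
  using L2_lin[of f g 1 "-1"] by simp

lemma L2_cnj: "f \<in> L2_space \<Longrightarrow> (\<lambda>x. cnj (f x)) \<in> L2_space"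
  by (auto simp: L2_space_def)

lemma L2_zero: "(\<lambda>x. 0) \<in> L2_space"
  by (simp add: L2_space_def)

lemma L2_sum:
  assumes "finite I" "\<And>i. i \<in> I \<Longrightarrow> b i \<in> L2_space"
  shows "(\<lambda>x. \<Sum>i\<in>I. c i * b i x) \<in> L2_space"
  using assms
proof (induction I rule: finite_induct)
  case (insert i I)
  then show ?case
    using L2_lin[of "b i" "\<lambda>x. \<Sum>i\<in>I. c i * b i x" "c i" 1] by simp
qed (simp add: L2_zero)

lemma L2_prod_integrable:
  assumes "f \<in> L2_space" "g \<in> L2_space"
  shows "integrable lebesgue (\<lambda>x. cnj (f x) * g x)"
proof (rule Bochner_Integration.integrable_bound)
  show "integrable lebesgue (\<lambda>x. (cmod (f x))\<^sup>2 + (cmod (g x))\<^sup>2)"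
    using assms by (auto dest: L2_integrable)
  have [measurable]: "f \<in> borel_measurable lebesgue" "g \<in> borel_measurable lebesgue"
    using assms by (auto dest: L2_measurable)
  show "(\<lambda>x. cnj (f x) * g x) \<in> borel_measurable lebesgue"
    by measurable
  have "a * b \<le> a\<^sup>2 + b\<^sup>2" if "a \<ge> 0" "b \<ge> 0" for a b :: real
  proof -
    have "2 * (a * b) \<le> a\<^sup>2 + b\<^sup>2" using sum_squares_bound[of a b] by (simp add: mult.assoc)
    moreover have "0 \<le> a * b" using that by simp
    ultimately show ?thesis by linarith
  qed
  then show "AE x in lebesgue. cmod (cnj (f x) * g x) \<le> norm ((cmod (f x))\<^sup>2 + (cmod (g x))\<^sup>2)"
    by (auto simp: norm_mult)
qed

lemma l2_inner_cnj: "l2_inner g f = cnj (l2_inner f g)"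
  unfolding l2_inner_def by (simp flip: Bochner_Integration.integral_cnj add: mult.commute)

lemma l2_inner_lin:
  assumes "h \<in> L2_space" "f \<in> L2_space" "g \<in> L2_space"
  shows "l2_inner h (\<lambda>x. a * f x + b * g x) = a * l2_inner h f + b * l2_inner h g"
proof -
  have "l2_inner h (\<lambda>x. a * f x + b * g x)
      = (LINT x|lebesgue. a * (cnj (h x) * f x) + b * (cnj (h x) * g x))"
    unfolding l2_inner_def by (simp add: algebra_simps)
  also have "\<dots> = a * l2_inner h f + b * l2_inner h g"
    unfolding l2_inner_def
    by (simp add: L2_prod_integrable[OF assms(1,2)] L2_prod_integrable[OF assms(1,3)])
  finally show ?thesis .
qed

lemma l2_inner_lin_left:
  assumes "h \<in> L2_space" "f \<in> L2_space" "g \<in> L2_space"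
  shows "l2_inner (\<lambda>x. a * f x + b * g x) h = cnj a * l2_inner f h + cnj b * l2_inner g h"
  unfolding l2_inner_cnj[of "\<lambda>x. a * f x + b * g x" h] l2_inner_cnj[of f h] l2_inner_cnj[of g h]
    l2_inner_lin[OF assms]
  by simp

lemma l2_inner_cmult: "h \<in> L2_space \<Longrightarrow> f \<in> L2_space \<Longrightarrow> l2_inner h (\<lambda>x. a * f x) = a * l2_inner h f"
  using l2_inner_lin[of h f f a 0] by simp

lemma l2_inner_diff:
  "h \<in> L2_space \<Longrightarrow> f \<in> L2_space \<Longrightarrow> g \<in> L2_space \<Longrightarrow>
    l2_inner h (\<lambda>x. f x - g x) = l2_inner h f - l2_inner h g"
  using l2_inner_lin[of h f g 1 "-1"] by simp

lemma l2_inner_diff_left: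
  "h \<in> L2_space \<Longrightarrow> f \<in> L2_space \<Longrightarrow> g \<in> L2_space \<Longrightarrow>
    l2_inner (\<lambda>x. f x - g x) h = l2_inner f h - l2_inner g h"
  using l2_inner_lin_left[of h f g 1 "-1"] by simp

lemma l2_inner_sum:
  assumes "h \<in> L2_space" "finite I" "\<And>i. i \<in> I \<Longrightarrow> b i \<in> L2_space"
  shows "l2_inner h (\<lambda>x. \<Sum>i\<in>I. c i * b i x) = (\<Sum>i\<in>I. c i * l2_inner h (b i))"
  using assms(2,3)
proof (induction I rule: finite_induct)
  case (insert i I)
  then show ?case
    using l2_inner_lin[OF assms(1), of "b i" "\<lambda>x. \<Sum>i\<in>I. c i * b i x" "c i" 1]
      L2_sum[of I b c] by simp
qed (simp add: l2_inner_def)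

lemma l2_inner_cong_AE:
  assumes "AE x in lebesgue. f x = f' x" "f \<in> L2_space" "f' \<in> L2_space" "h \<in> L2_space"
  shows "l2_inner h f = l2_inner h f'"
proof -
  have [measurable]: "f \<in> borel_measurable lebesgue" "f' \<in> borel_measurable lebesgue"
    "h \<in> borel_measurable lebesgue"
    using assms by (auto dest: L2_measurable)
  show ?thesis
    unfolding l2_inner_def
    by (rule integral_cong_AE) (use assms(1) in auto)
qed

lemma l2_norm_nonneg: "l2_norm f \<ge> 0"
  by (simp add: l2_norm_def)

lemma l2_norm_square: "(l2_norm f)\<^sup>2 = (LINT x|lebesgue. (cmod (f x))\<^sup>2)"
  by (simp add: l2_norm_def)

lemma l2_inner_self: "l2_inner f f = of_real ((l2_norm f)\<^sup>2)"
  unfolding l2_norm_square l2_inner_def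
  by (subst integral_complex_of_real[symmetric])
    (simp add: complex_norm_square mult.commute del: of_real_power)

lemma l2_norm_square_nn:
  "f \<in> L2_space \<Longrightarrow> ennreal ((l2_norm f)\<^sup>2) = (\<integral>\<^sup>+x. ennreal ((cmod (f x))\<^sup>2) \<partial>lebesgue)"
  unfolding l2_norm_square by (rule nn_integral_eq_integral[symmetric]) (auto dest: L2_integrable)

lemma l2_norm_eq_0_AE:
  assumes "f \<in> L2_space" "l2_norm f = 0"
  shows "AE x in lebesgue. f x = 0"
proof -
  have "(LINT x|lebesgue. (cmod (f x))\<^sup>2) = 0"
    using assms(2) l2_norm_square[of f] by simp
  then have "AE x in lebesgue. (cmod (f x))\<^sup>2 = 0"
    using assms(1) by (subst (asm) integral_nonneg_eq_0_iff_AE) (auto dest: L2_integrable)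
  then show ?thesis by simp
qed

section \<open>Bounded and non-negative operators through their matrix elements\<close>

text \<open>Linearity modulo null sets becomes an exact identity once tested against
  \<open>h\<close>; later operator identities are mostly used in this weak form. The bound is made
  positive because the square-root argument divides by it.\<close>

lemma bounded_opD:
  assumes "bounded_op T"
  shows "f \<in> L2_space \<Longrightarrow> T f \<in> L2_space"
    and "h \<in> L2_space \<Longrightarrow> f \<in> L2_space \<Longrightarrow> g \<in> L2_space \<Longrightarrow>
      l2_inner h (T (\<lambda>x. a * f x + b * g x)) = a * l2_inner h (T f) + b * l2_inner h (T g)"
    and "\<exists>M>0. \<forall>f\<in>L2_space. l2_norm (T f) \<le> M * l2_norm f"
proof -
  show *: "f \<in> L2_space \<Longrightarrow> T f \<in> L2_space" for f
    using assms by (auto simp: bounded_op_def)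
  show "l2_inner h (T (\<lambda>x. a * f x + b * g x)) = a * l2_inner h (T f) + b * l2_inner h (T g)"
    if "h \<in> L2_space" "f \<in> L2_space" "g \<in> L2_space"
  proof -
    have "l2_inner h (T (\<lambda>x. a * f x + b * g x)) = l2_inner h (\<lambda>x. a * T f x + b * T g x)"
      using that assms by (intro l2_inner_cong_AE) (auto simp: bounded_op_def intro!: * L2_lin)
    then show ?thesis using that * by (simp add: l2_inner_lin)
  qed
  obtain M where M: "\<forall>f\<in>L2_space. l2_norm (T f) \<le> M * l2_norm f"
    using assms by (auto simp: bounded_op_def)
  have "l2_norm (T f) \<le> max M 1 * l2_norm f" if "f \<in> L2_space" for f
    using M that mult_right_mono[OF max.cobounded1[of M 1] l2_norm_nonneg[of f]] by fastforce
  then show "\<exists>M>0. \<forall>f\<in>L2_space. l2_norm (T f) \<le> M * l2_norm f"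
    by (intro exI[of _ "max M 1"]) auto
qed

lemma nonneg_op_bounded: "nonneg_op T \<Longrightarrow> bounded_op T"
  by (simp add: nonneg_op_def)

lemma nonneg_op_form:
  assumes "nonneg_op T" "f \<in> L2_space"
  shows "Re (l2_inner f (T f)) \<ge> 0" "Im (l2_inner f (T f)) = 0"
  using assms by (auto simp: nonneg_op_def complex_nonneg_Reals_iff)

text \<open>The factor \<open>1 *\<close> keeps the argument in the shape
  \<open>a * f x + b * g x\<close>, for which linearity is available.\<close>

lemma bounded_op_form_add:
  assumes "bounded_op T" "f \<in> L2_space" "g \<in> L2_space"
  shows "l2_inner (\<lambda>x. 1 * f x + c * g x) (T (\<lambda>x. 1 * f x + c * g x))
    = l2_inner f (T f) + c * l2_inner f (T g) + cnj c * l2_inner g (T f)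
      + cnj c * c * l2_inner g (T g)"
proof -
  let ?w = "\<lambda>x. 1 * f x + c * g x"
  note T = bounded_opD[OF assms(1)]
  have w: "?w \<in> L2_space" using assms by (intro L2_lin)
  have "l2_inner ?w (T ?w) = l2_inner ?w (T f) + c * l2_inner ?w (T g)"
    using T(2)[OF w assms(2,3), of 1 c] by simp
  also have "\<dots> = (l2_inner f (T f) + cnj c * l2_inner g (T f))
      + c * (l2_inner f (T g) + cnj c * l2_inner g (T g))"
    using l2_inner_lin_left[of "T f" f g 1 c] l2_inner_lin_left[of "T g" f g 1 c] T(1) assms
    by simp
  finally show ?thesis by (simp add: algebra_simps)
qed

text \<open>Polarization: the form is real at f + c g; c = 1 compares the imaginary parts of the two
  cross terms, c = \<i> their real parts.\<close>

lemma nonneg_op_symmetric: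
  assumes "nonneg_op T" "f \<in> L2_space" "g \<in> L2_space"
  shows "l2_inner g (T f) = cnj (l2_inner f (T g))"
proof (rule complex_eqI)
  note add = bounded_op_form_add[OF nonneg_op_bounded[OF assms(1)] assms(2,3)]
  have im: "Im (l2_inner (\<lambda>x. 1 * f x + c * g x) (T (\<lambda>x. 1 * f x + c * g x))) = 0" for c
    by (rule nonneg_op_form[OF assms(1) L2_lin[OF assms(2,3)]])
  show "Im (l2_inner g (T f)) = Im (cnj (l2_inner f (T g)))"
    using im[of 1] nonneg_op_form(2)[OF assms(1,2)] nonneg_op_form(2)[OF assms(1,3)]
    unfolding add by simp
  show "Re (l2_inner g (T f)) = Re (cnj (l2_inner f (T g)))"
    using im[of \<i>] nonneg_op_form(2)[OF assms(1,2)] nonneg_op_form(2)[OF assms(1,3)]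
    unfolding add by simp
qed

lemma nonneg_op_adjoint:
  assumes "nonneg_op T" "f \<in> L2_space" "g \<in> L2_space"
  shows "l2_inner g (T f) = l2_inner (T g) f"
  using nonneg_op_symmetric[OF assms] l2_inner_cnj[of "T g" f] by simp

lemma nonneg_op_Cauchy_Schwarz:
  assumes "nonneg_op T" "f \<in> L2_space" "g \<in> L2_space"
  shows "(cmod (l2_inner f (T g)))\<^sup>2 \<le> Re (l2_inner f (T f)) * Re (l2_inner g (T g))"
proof -
  define z where "z = l2_inner f (T g)"
  define p where "p = Re (l2_inner f (T f))"
  define q where "q = Re (l2_inner g (T g))"
  have "p \<ge> 0" "q \<ge> 0" unfolding p_def q_def using nonneg_op_form assms by auto
  have *: "p - 2 * t * (cmod z)\<^sup>2 + t\<^sup>2 * (cmod z)\<^sup>2 * q \<ge> 0" for t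
  proof -
    \<comment> \<open>This phase makes \<open>c * z\<close> real, so positivity at f + c g becomes a
      quadratic inequality in the real number t.\<close>
    define c where "c = - (of_real t * cnj z)"
    have "0 \<le> Re (l2_inner (\<lambda>x. 1 * f x + c * g x) (T (\<lambda>x. 1 * f x + c * g x)))"
      by (rule nonneg_op_form[OF assms(1) L2_lin[OF assms(2,3)]])
    also have "\<dots> = p + Re (c * z + cnj (c * z)) + Re (cnj c * c * l2_inner g (T g))"
      unfolding bounded_op_form_add[OF nonneg_op_bounded[OF assms(1)] assms(2,3)]
      using nonneg_op_symmetric[OF assms] by (simp add: z_def p_def)
    also have "c * z = - of_real (t * (cmod z)\<^sup>2)"
      unfolding c_def by (simp add: complex_norm_square del: of_real_power)
    also have "cnj c * c = of_real (t\<^sup>2 * (cmod z)\<^sup>2)"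
      unfolding c_def of_real_mult complex_norm_square by (simp add: power2_eq_square algebra_simps)
    finally show ?thesis by (simp add: q_def flip: of_real_mult)
  qed
  have "(cmod z)\<^sup>2 \<le> p * q"
  proof (cases "q = 0")
    case True
    have "(cmod z)\<^sup>2 = 0"
    proof (rule ccontr)
      assume "(cmod z)\<^sup>2 \<noteq> 0"
      \<comment> \<open>With q = 0 the expression is linear in t; at this t it equals p - (p + 1) =
        -1.\<close>
      then show False
        using *[of "(p + 1) / (2 * (cmod z)\<^sup>2)"] True \<open>p \<ge> 0\<close> by simp
    qed
    then show ?thesis using True by simp
  next
    case False
    then have "q > 0" using \<open>q \<ge> 0\<close> by simp
    \<comment> \<open>t = 1/q minimizes the quadratic.\<close>
    have "p - 2 * (1/q) * (cmod z)\<^sup>2 + (1/q)\<^sup>2 * (cmod z)\<^sup>2 * q = p - (cmod z)\<^sup>2 / q"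
      using \<open>q > 0\<close> by (simp add: field_simps power2_eq_square)
    then have "(cmod z)\<^sup>2 / q \<le> p" using *[of "1/q"] by simp
    then show ?thesis using \<open>q > 0\<close> by (simp add: field_simps)
  qed
  then show ?thesis by (simp add: z_def p_def q_def)
qed

text \<open>The identity specializes the results on forms: Cauchy-Schwarz for the inner product and
  the expansion of a squared norm.\<close>

lemma nonneg_op_id: "nonneg_op (\<lambda>f. f)"
  unfolding nonneg_op_def bounded_op_def
  by (auto simp: l2_inner_self complex_nonneg_Reals_iff intro!: exI[of _ 1])

lemma l2_Cauchy_Schwarz:
  assumes "f \<in> L2_space" "g \<in> L2_space"
  shows "cmod (l2_inner f g) \<le> l2_norm f * l2_norm g"
proof (rule power2_le_imp_le)
  show "(cmod (l2_inner f g))\<^sup>2 \<le> (l2_norm f * l2_norm g)\<^sup>2"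
    using nonneg_op_Cauchy_Schwarz[OF nonneg_op_id assms]
    by (simp add: l2_inner_self power_mult_distrib)
qed (simp add: l2_norm_nonneg)

lemma l2_norm_square_add:
  assumes "f \<in> L2_space" "g \<in> L2_space"
  shows "(l2_norm (\<lambda>x. 1 * f x + c * g x))\<^sup>2
    = (l2_norm f)\<^sup>2 + 2 * Re (c * l2_inner f g) + (cmod c)\<^sup>2 * (l2_norm g)\<^sup>2"
proof -
  have "complex_of_real ((l2_norm (\<lambda>x. 1 * f x + c * g x))\<^sup>2)
      = of_real ((l2_norm f)\<^sup>2) + (c * l2_inner f g + cnj (c * l2_inner f g))
        + cnj c * c * of_real ((l2_norm g)\<^sup>2)"
    using bounded_op_form_add[OF nonneg_op_bounded[OF nonneg_op_id] assms, of c]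
    unfolding l2_inner_self by (simp add: l2_inner_cnj[of g f])
  also have "cnj c * c = of_real ((cmod c)\<^sup>2)"
    by (simp add: complex_norm_square mult.commute del: of_real_power)
  finally have "complex_of_real ((l2_norm (\<lambda>x. 1 * f x + c * g x))\<^sup>2) =
    of_real ((l2_norm f)\<^sup>2 + 2 * Re (c * l2_inner f g) + (cmod c)\<^sup>2 * (l2_norm g)\<^sup>2)"
    by (simp add: complex_add_cnj del: of_real_power complex_cnj_mult)
  then show ?thesis using of_real_eq_iff by blast
qed


section \<open>Uniqueness of the positive square root\<close>

text \<open>This is K^2 \<le> M K. Cauchy-Schwarz for the form of K at f and K f bounds |K f|^4 by
  <f, K f> <K f, K K f>, and the last factor is at most M |K f|^2. It makes 1 - K/M a
  contraction.\<close>

lemma nonneg_op_norm_bound: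
  assumes K: "nonneg_op K" and M: "M > 0" "\<And>f. f \<in> L2_space \<Longrightarrow> l2_norm (K f) \<le> M * l2_norm f"
    and f: "f \<in> L2_space"
  shows "(l2_norm (K f))\<^sup>2 \<le> M * Re (l2_inner f (K f))"
proof -
  define a where "a = (l2_norm (K f))\<^sup>2"
  define q where "q = Re (l2_inner f (K f))"
  have Kf: "K f \<in> L2_space" using bounded_opD(1)[OF nonneg_op_bounded[OF K] f] .
  then have KKf: "K (K f) \<in> L2_space" using bounded_opD(1)[OF nonneg_op_bounded[OF K]] by blast
  have q: "q \<ge> 0" unfolding q_def by (rule nonneg_op_form[OF K f])
  have "l2_inner (K f) (K f) = l2_inner f (K (K f))"
    using nonneg_op_adjoint[OF K Kf f] by simp
  then have "l2_inner f (K (K f)) = of_real a"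
    unfolding l2_inner_self a_def by simp
  then have "a\<^sup>2 = (cmod (l2_inner f (K (K f))))\<^sup>2" by simp
  also have "\<dots> \<le> q * Re (l2_inner (K f) (K (K f)))"
    unfolding q_def by (rule nonneg_op_Cauchy_Schwarz[OF K f Kf])
  also have "\<dots> \<le> q * (M * a)"
  proof (rule mult_left_mono[OF _ q])
    have "Re (l2_inner (K f) (K (K f))) \<le> cmod (l2_inner (K f) (K (K f)))"
      by (rule complex_Re_le_cmod)
    also have "\<dots> \<le> l2_norm (K f) * l2_norm (K (K f))"
      by (rule l2_Cauchy_Schwarz[OF Kf KKf])
    also have "\<dots> \<le> l2_norm (K f) * (M * l2_norm (K f))"
      by (intro mult_left_mono M Kf l2_norm_nonneg)
    finally show "Re (l2_inner (K f) (K (K f))) \<le> M * a"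
      by (simp add: a_def power2_eq_square algebra_simps)
  qed
  finally have "a * a \<le> (M * q) * a" by (simp add: power2_eq_square algebra_simps)
  moreover have "a \<ge> 0" by (simp add: a_def)
  moreover have "M * q \<ge> 0" using M q by simp
  ultimately have "a \<le> M * q"
    by (cases "a = 0") (auto simp: mult_le_cancel_right)
  then show ?thesis by (simp add: a_def q_def)
qed

text \<open>
  With \<open>D = P - K\<close> the hypothesis reads \<open>P D = - D K\<close>, so \<open>D\<close> intertwines the contraction
  \<open>1 - K/M\<close> with the expansion \<open>1 + P/M\<close>. Iterating, \<open>\<parallel>(1 + P/M)\<^sup>k D f\<parallel>\<close> stays bounded, while its
  square grows at least like \<open>2k \<langle>D f, P D f\<rangle> / M\<close>.
\<close>

lemma nonneg_sqrt_diff_form: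
  assumes P: "nonneg_op P" and K: "nonneg_op K"
    and eq: "\<And>f g. f \<in> L2_space \<Longrightarrow> g \<in> L2_space \<Longrightarrow>
      l2_inner f (P (P g)) = l2_inner f (K (K g))"
    and f: "f \<in> L2_space"
  shows "l2_inner (\<lambda>x. P f x - K f x) (P (\<lambda>x. P f x - K f x)) = 0"
proof -
  note Pb = bounded_opD[OF nonneg_op_bounded[OF P]]
  note Kb = bounded_opD[OF nonneg_op_bounded[OF K]]
  obtain M where M: "M > 0" "\<And>f. f \<in> L2_space \<Longrightarrow> l2_norm (K f) \<le> M * l2_norm f"
    using Kb(3) by blast
  obtain N where N: "N > 0" "\<And>f. f \<in> L2_space \<Longrightarrow> l2_norm (P f) \<le> N * l2_norm f"
    using Pb(3) by blast
  define c where "c = complex_of_real (1 / M)"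
  \<comment> \<open>\<open>F k\<close> is (1 - K/M)^k f.\<close>
  define F where "F = rec_nat f (\<lambda>_ g x. 1 * g x + (- c) * K g x)"
  define D where "D = (\<lambda>g x. P g x - K g x)"
  define q where "q = (\<lambda>g. Re (l2_inner g (P g)))"
  have F0: "F 0 = f" and FS: "F (Suc k) = (\<lambda>x. 1 * F k x + (- c) * K (F k) x)" for k
    by (auto simp: F_def)
  have FL: "F k \<in> L2_space" for k
    by (induction k) (auto simp only: F0 FS intro!: f L2_lin Kb)
  have DL: "D g \<in> L2_space" if "g \<in> L2_space" for g
    unfolding D_def by (intro L2_diff Pb Kb that)
  \<comment> \<open>D (1 - K/M) = (1 + P/M) D, tested against h: with P P = K K this reduces to P D
    = K K - P K = - D K.\<close>
  have step: "l2_inner h (D (F (Suc k))) = l2_inner h (\<lambda>x. 1 * D (F k) x + c * P (D (F k)) x)"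
    if h: "h \<in> L2_space" for h k
  proof -
    let ?g = "F k"
    note L = FL[of k] Pb(1) Kb(1) DL
    have "l2_inner h (P (D ?g)) = l2_inner h (P (P ?g)) - l2_inner h (P (K ?g))"
      using Pb(2)[OF h Pb(1)[OF FL[of k]] Kb(1)[OF FL[of k]], where a = 1 and b = "-1"] by (simp add: D_def)
    then have *: "l2_inner h (P (D ?g)) = l2_inner h (K (K ?g)) - l2_inner h (P (K ?g))"
      using eq[OF h FL[of k]] by simp
    have "l2_inner h (D (F (Suc k))) = l2_inner h (P (F (Suc k))) - l2_inner h (K (F (Suc k)))"
      unfolding D_def by (intro l2_inner_diff h Pb Kb FL)
    also have "\<dots> = l2_inner h (P ?g) - c * l2_inner h (P (K ?g))
        - (l2_inner h (K ?g) - c * l2_inner h (K (K ?g)))"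
      unfolding FS using Pb(2)[OF h FL[of k] Kb(1)[OF FL[of k]], where a = 1 and b = "-c"]
        Kb(2)[OF h FL[of k] Kb(1)[OF FL[of k]], where a = 1 and b = "-c"] by simp
    also have "\<dots> = l2_inner h (P ?g) - l2_inner h (K ?g) + c * l2_inner h (P (D ?g))"
      by (simp add: * algebra_simps)
    also have "\<dots> = l2_inner h (\<lambda>x. 1 * D ?g x + c * P (D ?g) x)"
      using l2_inner_lin[of h "D ?g" "P (D ?g)" 1 c] l2_inner_diff[of h "P ?g" "K ?g"] h L
      by (simp add: D_def)
    finally show ?thesis .
  qed
  have eqAE: "AE x in lebesgue. D (F (Suc k)) x = 1 * D (F k) x + c * P (D (F k)) x" for k
  proof -
    let ?r = "\<lambda>x. 1 * D (F k) x + c * P (D (F k)) x"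
    have r: "?r \<in> L2_space" by (intro L2_lin DL Pb FL)
    have d: "(\<lambda>x. D (F (Suc k)) x - ?r x) \<in> L2_space" by (intro L2_diff r DL FL)
    have "l2_inner (\<lambda>x. D (F (Suc k)) x - ?r x) (\<lambda>x. D (F (Suc k)) x - ?r x) = 0"
      using l2_inner_diff[OF d DL[OF FL[of "Suc k"]] r] step[OF d, of k] by simp
    then have "l2_norm (\<lambda>x. D (F (Suc k)) x - ?r x) = 0"
      unfolding l2_inner_self by simp
    from l2_norm_eq_0_AE[OF d this] show ?thesis by simp
  qed
  \<comment> \<open>|(1 + P/M) y|^2 exceeds |y|^2 by 2/M <y, P y> plus a square. Since
    \<open>step\<close> is an identity under test functions, it is applied once in each slot of the
    inner product.\<close>
  have normS: "(l2_norm (D (F (Suc k))))\<^sup>2 \<ge> (l2_norm (D (F k)))\<^sup>2 + 2 / M * q (D (F k))" for k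
  proof -
    let ?r = "\<lambda>x. 1 * D (F k) x + c * P (D (F k)) x"
    have r: "?r \<in> L2_space" by (intro L2_lin DL Pb FL)
    have "l2_inner (D (F (Suc k))) (D (F (Suc k))) = cnj (l2_inner ?r (D (F (Suc k))))"
      unfolding step[OF DL[OF FL]] by (rule l2_inner_cnj)
    also have "\<dots> = l2_inner ?r ?r"
      unfolding step[OF r] by (rule l2_inner_cnj[symmetric])
    finally have "l2_inner (D (F (Suc k))) (D (F (Suc k))) = l2_inner ?r ?r" .
    then have "(l2_norm (D (F (Suc k))))\<^sup>2 = (l2_norm ?r)\<^sup>2"
      unfolding l2_inner_self of_real_eq_iff .
    also have "\<dots> \<ge> (l2_norm (D (F k)))\<^sup>2 + 2 / M * q (D (F k))"
      unfolding l2_norm_square_add[OF DL[OF FL[of k]] Pb(1)[OF DL[OF FL[of k]]]] q_def c_def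
      by (simp add: Re_divide_of_real)
    finally show ?thesis .
  qed
  \<comment> \<open>Passing from y to (1 + P/M) y adds to <y, P y> the terms 2/M |P y|^2 and <P y, P
    P y>/M^2, both non-negative.\<close>
  have qS: "q (D (F (Suc k))) \<ge> q (D (F k))" for k
  proof -
    let ?y = "D (F k)"
    let ?r = "\<lambda>x. 1 * ?y x + c * P ?y x"
    have r: "?r \<in> L2_space" by (intro L2_lin DL Pb FL)
    have y: "?y \<in> L2_space" "P ?y \<in> L2_space" by (intro DL Pb FL)+
    have Peq: "l2_inner h (P (D (F (Suc k)))) = l2_inner h (P ?r)" if h: "h \<in> L2_space" for h
    proof -
      have "l2_inner h (P (D (F (Suc k)))) = l2_inner (P h) (D (F (Suc k)))"
        by (intro nonneg_op_adjoint P DL FL h)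
      also have "\<dots> = l2_inner (P h) ?r" by (rule step[OF Pb(1)[OF h]])
      also have "\<dots> = l2_inner h (P ?r)" by (intro nonneg_op_adjoint[symmetric] P r h)
      finally show ?thesis .
    qed
    have "l2_inner (D (F (Suc k))) (P (D (F (Suc k)))) = l2_inner (D (F (Suc k))) (P ?r)"
      by (intro Peq DL FL)
    also have "\<dots> = cnj (l2_inner (P ?r) ?r)"
      unfolding step[OF Pb(1)[OF r], symmetric] by (rule l2_inner_cnj)
    also have "\<dots> = l2_inner ?r (P ?r)" by (rule l2_inner_cnj[symmetric])
    also have "\<dots> = l2_inner ?y (P ?y) + c * l2_inner ?y (P (P ?y)) + cnj c * l2_inner (P ?y) (P ?y)
        + cnj c * c * l2_inner (P ?y) (P (P ?y))"
      by (intro bounded_op_form_add nonneg_op_bounded P y)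
    also have "l2_inner ?y (P (P ?y)) = l2_inner (P ?y) (P ?y)"
      by (intro nonneg_op_adjoint P y)
    finally have "q (D (F (Suc k))) = q ?y + 2 / M * (l2_norm (P ?y))\<^sup>2 + 1 / M\<^sup>2 * q (P ?y)"
      unfolding l2_inner_self q_def by (simp add: c_def power2_eq_square flip: of_real_power)
    moreover have "q (P ?y) \<ge> 0" unfolding q_def by (rule nonneg_op_form[OF P y(2)])
    ultimately show ?thesis using M(1) by simp
  qed
  have q0: "q (D f) \<le> q (D (F k))" for k
    by (induction k) (auto simp: F0 intro: order_trans[OF _ qS])
  have grow: "(l2_norm (D f))\<^sup>2 + real k * (2 / M * q (D f)) \<le> (l2_norm (D (F k)))\<^sup>2" for k
  proof (induction k)
    case (Suc k)
    have "2 / M * q (D f) \<le> 2 / M * q (D (F k))"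
      using q0[of k] M(1) by (intro mult_left_mono) auto
    moreover have "real (Suc k) * (2 / M * q (D f)) = real k * (2 / M * q (D f)) + 2 / M * q (D f)"
      by (simp only: of_nat_Suc distrib_right mult_1)
    ultimately show ?case using Suc normS[of k] by linarith
  qed (simp add: F0)
  \<comment> \<open>In the expansion of |g - K g/M|^2 the term |K g|^2/M^2 is at most <g, K g>/M,
    half of what the cross term subtracts.\<close>
  have contr: "(l2_norm (F (Suc k)))\<^sup>2 \<le> (l2_norm (F k))\<^sup>2" for k
  proof -
    have "(l2_norm (K (F k)))\<^sup>2 \<le> M * Re (l2_inner (F k) (K (F k)))"
      by (rule nonneg_op_norm_bound[OF K M FL])
    then have "(l2_norm (K (F k)))\<^sup>2 / M\<^sup>2 \<le> Re (l2_inner (F k) (K (F k))) / M"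
      using M(1) by (simp add: field_simps power2_eq_square)
    moreover have "Re (l2_inner (F k) (K (F k))) / M \<ge> 0"
      using nonneg_op_form(1)[OF K FL[of k]] M(1) by simp
    ultimately show ?thesis
      unfolding FS l2_norm_square_add[OF FL Kb(1)[OF FL[of k]]] c_def using M(1)
      by (simp add: power_divide norm_divide Re_divide_of_real)
  qed
  have Fb: "l2_norm (F k) \<le> l2_norm f" for k
  proof -
    have "(l2_norm (F k))\<^sup>2 \<le> (l2_norm f)\<^sup>2"
      by (induction k) (auto simp: F0 intro: order_trans[OF contr])
    then show ?thesis by (rule power2_le_imp_le) (rule l2_norm_nonneg)
  qed
  \<comment> \<open>Parallelogram identity for P g and K g, with the square of their sum
    dropped.\<close>
  have Db: "(l2_norm (D g))\<^sup>2 \<le> 2 * (N * l2_norm g)\<^sup>2 + 2 * (M * l2_norm g)\<^sup>2"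
    if g: "g \<in> L2_space" for g
  proof -
    have "(l2_norm (D g))\<^sup>2 + (l2_norm (\<lambda>x. 1 * P g x + 1 * K g x))\<^sup>2
        = 2 * (l2_norm (P g))\<^sup>2 + 2 * (l2_norm (K g))\<^sup>2"
      using l2_norm_square_add[of "P g" "K g" 1] l2_norm_square_add[of "P g" "K g" "-1"]
        Pb(1)[OF g] Kb(1)[OF g]
      by (simp add: D_def)
    moreover have "(l2_norm (P g))\<^sup>2 \<le> (N * l2_norm g)\<^sup>2"
      by (intro power_mono N g l2_norm_nonneg)
    moreover have "(l2_norm (K g))\<^sup>2 \<le> (M * l2_norm g)\<^sup>2"
      by (intro power_mono M g l2_norm_nonneg)
    ultimately show ?thesis
      using zero_le_power2[of "l2_norm (\<lambda>x. 1 * P g x + 1 * K g x)"] by linarith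
  qed
  define B where "B = 2 * (N * l2_norm f)\<^sup>2 + 2 * (M * l2_norm f)\<^sup>2"
  have "(l2_norm (D (F k)))\<^sup>2 \<le> B" for k
  proof -
    have "(N * l2_norm (F k))\<^sup>2 \<le> (N * l2_norm f)\<^sup>2" "(M * l2_norm (F k))\<^sup>2 \<le> (M * l2_norm f)\<^sup>2"
      using M N Fb[of k] by (auto intro!: power_mono mult_left_mono mult_nonneg_nonneg l2_norm_nonneg)
    then show ?thesis using Db[OF FL[of k]] unfolding B_def by linarith
  qed
  then have bd: "real k * (2 / M * q (D f)) \<le> B" for k
    using grow[of k] zero_le_power2[of "l2_norm (D f)"] by (smt (verit))
  have "q (D f) \<ge> 0" unfolding q_def by (rule nonneg_op_form[OF P DL[OF f]])
  moreover have "\<not> q (D f) > 0"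
  proof
    assume "q (D f) > 0"
    then have "2 / M * q (D f) > 0" using M(1) by simp
    then obtain k where "B < real k * (2 / M * q (D f))"
      using reals_Archimedean3 by blast
    then show False using bd[of k] by simp
  qed
  ultimately have "q (D f) = 0" by simp
  then show ?thesis
    using nonneg_op_form(2)[OF P DL[OF f]] by (auto simp: q_def D_def complex_eq_iff)
qed

lemma nonneg_op_form_zero:
  assumes "nonneg_op T" "f \<in> L2_space" "h \<in> L2_space" "l2_inner f (T f) = 0"
  shows "l2_inner h (T f) = 0"
  using nonneg_op_Cauchy_Schwarz[OF assms(1,3,2)] assms(4) by simp

text \<open>With d = (P - K) f, \<open>nonneg_sqrt_diff_form\<close> used in both orders gives <d, P
  d> = <d, K d> = 0, hence P d and K d vanish weakly, and <d, d> = <f, P d - K d> = 0.\<close>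

lemma nonneg_sqrt_unique:
  assumes P: "nonneg_op P" and K: "nonneg_op K"
    and eq: "\<And>f g. f \<in> L2_space \<Longrightarrow> g \<in> L2_space \<Longrightarrow>
      l2_inner f (P (P g)) = l2_inner f (K (K g))"
    and f: "f \<in> L2_space" and g: "g \<in> L2_space"
  shows "l2_inner g (P f) = l2_inner g (K f)"
proof -
  note Pb = bounded_opD[OF nonneg_op_bounded[OF P]]
  note Kb = bounded_opD[OF nonneg_op_bounded[OF K]]
  define d where "d = (\<lambda>x. P f x - K f x)"
  have d: "d \<in> L2_space" unfolding d_def by (intro L2_diff Pb Kb f)
  have 1: "l2_inner d (P d) = 0"
    unfolding d_def by (rule nonneg_sqrt_diff_form[OF P K eq f])
  \<comment> \<open>e = -d, written as a combination so that linearity of K applies.\<close>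
  define e where "e = (\<lambda>x. 0 * f x + (-1) * d x)"
  have e: "e \<in> L2_space" unfolding e_def by (intro L2_lin f d)
  have e_eq: "e = (\<lambda>x. K f x - P f x)" by (auto simp: e_def d_def)
  have "l2_inner e (K e) = 0"
    unfolding e_eq by (rule nonneg_sqrt_diff_form[OF K P eq[symmetric] f])
  moreover have "l2_inner e (K e) = l2_inner d (K d)"
    using Kb(2)[OF e f d, of 0 "-1"] l2_inner_lin_left[OF Kb(1)[OF d] f d, of 0 "-1"]
    unfolding e_def by simp
  ultimately have 2: "l2_inner d (K d) = 0" by simp
  have "l2_inner f (P d) = 0" "l2_inner f (K d) = 0"
    using nonneg_op_form_zero[OF P d f 1] nonneg_op_form_zero[OF K d f 2] by auto
  then have "l2_inner (P f) d = 0" "l2_inner (K f) d = 0"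
    using nonneg_op_adjoint[OF P d f] nonneg_op_adjoint[OF K d f] by simp_all
  moreover have "l2_inner d d = l2_inner (P f) d - l2_inner (K f) d"
    using l2_inner_diff_left[OF d Pb(1)[OF f] Kb(1)[OF f]] by (simp add: d_def)
  ultimately have "l2_norm d = 0" unfolding l2_inner_self by simp
  then have "cmod (l2_inner g d) \<le> 0" using l2_Cauchy_Schwarz[OF g d] by simp
  then show ?thesis
    using l2_inner_diff[OF g Pb(1)[OF f] Kb(1)[OF f]] by (simp add: d_def)
qed

text \<open>K itself meets the condition under the choice in \<open>op_abs\<close>, so the chosen
  operator meets it too, and uniqueness of the root identifies the two.\<close>

lemma l2_inner_op_abs:
  assumes K: "nonneg_op K" and f: "f \<in> L2_space" and g: "g \<in> L2_space"
  shows "l2_inner g (op_abs K f) = l2_inner g (K f)"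
proof -
  let ?Q = "\<lambda>P. nonneg_op P \<and>
     (\<forall>f\<in>L2_space. \<forall>g\<in>L2_space. l2_inner f (P (P g)) = l2_inner (K f) (K g))"
  have K2: "l2_inner f (K (K g)) = l2_inner (K f) (K g)" if "f \<in> L2_space" "g \<in> L2_space" for f g
    using that bounded_opD(1)[OF nonneg_op_bounded[OF K]] by (intro nonneg_op_adjoint K) auto
  then have "?Q K" using K by blast
  then have "?Q (op_abs K)" unfolding op_abs_def by (rule someI[where P = ?Q])
  then show ?thesis
    using K2 by (intro nonneg_sqrt_unique[OF _ K _ f g]) auto
qed


section \<open>Operators with a square-integrable frame kernel\<close>

text \<open>The squared distance from f to its projection p on the span is |f|^2 - S, hence S \<le>
  |f|^2.\<close>

lemma Bessel_finite:
  assumes I: "finite I" and e: "\<And>i. i \<in> I \<Longrightarrow> e i \<in> L2_space"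
    and orth: "\<And>i j. i \<in> I \<Longrightarrow> j \<in> I \<Longrightarrow> l2_inner (e i) (e j) = (if i = j then 1 else 0)"
    and f: "f \<in> L2_space"
  shows "(\<Sum>i\<in>I. (cmod (l2_inner (e i) f))\<^sup>2) \<le> (l2_norm f)\<^sup>2"
proof -
  define c where "c = (\<lambda>i. l2_inner (e i) f)"
  define p where "p = (\<lambda>x. \<Sum>i\<in>I. c i * e i x)"
  define S where "S = (\<Sum>i\<in>I. (cmod (c i))\<^sup>2)"
  have p: "p \<in> L2_space" unfolding p_def by (intro L2_sum I e)
  have S: "(\<Sum>i\<in>I. c i * cnj (c i)) = of_real S"
    unfolding S_def of_real_sum by (intro sum.cong refl) (simp add: complex_norm_square del: of_real_power)
  have ep: "l2_inner (e i) p = c i" if "i \<in> I" for i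
  proof -
    have "l2_inner (e i) p = (\<Sum>j\<in>I. c j * l2_inner (e i) (e j))"
      unfolding p_def by (intro l2_inner_sum I e that)
    also have "\<dots> = (\<Sum>j\<in>I. if i = j then c j else 0)"
      using that by (intro sum.cong) (auto simp: orth)
    finally show ?thesis using that I by simp
  qed
  have "l2_inner p p = (\<Sum>i\<in>I. c i * l2_inner p (e i))"
    by (subst (2) p_def) (intro l2_inner_sum p I e)
  also have "\<dots> = (\<Sum>i\<in>I. c i * cnj (c i))"
    by (intro sum.cong refl) (simp add: l2_inner_cnj[of p] ep)
  finally have pp: "(l2_norm p)\<^sup>2 = S"
    unfolding S l2_inner_self of_real_eq_iff .
  have "l2_inner f p = (\<Sum>i\<in>I. c i * l2_inner f (e i))"
    unfolding p_def by (intro l2_inner_sum f I e)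
  also have "\<dots> = of_real S"
    unfolding S[symmetric] by (intro sum.cong refl) (simp add: l2_inner_cnj[of f] c_def)
  finally have "l2_inner f p = of_real S" .
  then have "(l2_norm (\<lambda>x. 1 * f x + (-1) * p x))\<^sup>2 = (l2_norm f)\<^sup>2 - S"
    unfolding l2_norm_square_add[OF f p] pp by simp
  then have "S \<le> (l2_norm f)\<^sup>2"
    using zero_le_power2[of "l2_norm (\<lambda>x. 1 * f x + (-1) * p x)"] by linarith
  then show ?thesis by (simp add: S_def c_def)
qed

lemma Bessel_nn:
  assumes e: "orthonormal_basis e" and f: "f \<in> L2_space"
  shows "(\<Sum>n. ennreal ((cmod (l2_inner f (e n)))\<^sup>2)) \<le> ennreal ((l2_norm f)\<^sup>2)"
proof (rule suminf_le_const)
  fix N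
  have "(\<Sum>n<N. (cmod (l2_inner f (e n)))\<^sup>2) = (\<Sum>n<N. (cmod (l2_inner (e n) f))\<^sup>2)"
    by (intro sum.cong refl) (simp add: l2_inner_cnj[of f])
  also have "\<dots> \<le> (l2_norm f)\<^sup>2"
    using e f by (intro Bessel_finite) (auto simp: orthonormal_basis_def)
  finally show "(\<Sum>n<N. ennreal ((cmod (l2_inner f (e n)))\<^sup>2)) \<le> ennreal ((l2_norm f)\<^sup>2)"
    by (simp add: sum_ennreal ennreal_leI)
qed simp

text \<open>A Hilbert-Schmidt kernel, with frequency as first and position as second argument. Every
  slice in position lies in \<open>L2_space\<close>, so \<open>analysis\<close> is a genuine inner
  product at each frequency.\<close>

locale hs_kernel =
  fixes h :: "real^'d::finite \<Rightarrow> real^'d \<Rightarrow> complex"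
  assumes kernel_measurable [measurable]: "case_prod h \<in> borel_measurable (lebesgue \<Otimes>\<^sub>M lebesgue)"
    and slice_L2: "h \<xi> \<in> L2_space"
    and kernel_finite: "(\<integral>\<^sup>+\<xi>. \<integral>\<^sup>+x. ennreal ((cmod (h \<xi> x))\<^sup>2) \<partial>lebesgue \<partial>lebesgue) < \<infinity>"
begin

definition hs_trace :: real where
  "hs_trace = enn2real (\<integral>\<^sup>+\<xi>. \<integral>\<^sup>+x. ennreal ((cmod (h \<xi> x))\<^sup>2) \<partial>lebesgue \<partial>lebesgue)"

definition analysis :: "(real^'d \<Rightarrow> complex) \<Rightarrow> real^'d \<Rightarrow> complex" where
  "analysis u = (\<lambda>\<xi>. l2_inner (h \<xi>) u)"

text \<open>This is A^* A for the Hilbert-Schmidt operator A = \<open>analysis\<close>;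
  \<open>hs_trace\<close> is the squared Hilbert-Schmidt norm of A.\<close>

definition frame_op :: "(real^'d \<Rightarrow> complex) \<Rightarrow> real^'d \<Rightarrow> complex" where
  "frame_op u = (\<lambda>x. LINT \<xi>|lebesgue. h \<xi> x * analysis u \<xi>)"

lemma hs_trace_nonneg: "hs_trace \<ge> 0"
  by (simp add: hs_trace_def)

lemma hs_trace_eq:
  "(\<integral>\<^sup>+\<xi>. \<integral>\<^sup>+x. ennreal ((cmod (h \<xi> x))\<^sup>2) \<partial>lebesgue \<partial>lebesgue) = ennreal hs_trace"
  using kernel_finite by (simp add: hs_trace_def less_top)

lemma hs_trace_slice: "(\<integral>\<^sup>+\<xi>. ennreal ((l2_norm (h \<xi>))\<^sup>2) \<partial>lebesgue) = ennreal hs_trace"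
  unfolding hs_trace_eq[symmetric] by (simp add: l2_norm_square_nn slice_L2)

lemma kernel_square_integrable:
  "integrable (lebesgue \<Otimes>\<^sub>M lebesgue) (\<lambda>(\<xi>, x). (cmod (h \<xi> x))\<^sup>2)"
proof (rule integrableI_bounded)
  have "(\<integral>\<^sup>+p. ennreal (norm (case p of (\<xi>, x) \<Rightarrow> (cmod (h \<xi> x))\<^sup>2)) \<partial>(lebesgue \<Otimes>\<^sub>M lebesgue))
      = (\<integral>\<^sup>+\<xi>. \<integral>\<^sup>+x. ennreal ((cmod (h \<xi> x))\<^sup>2) \<partial>lebesgue \<partial>lebesgue)"
    by (subst leb.nn_integral_fst[symmetric]) (auto intro!: nn_integral_cong)
  then show "(\<integral>\<^sup>+p. ennreal (norm (case p of (\<xi>, x) \<Rightarrow> (cmod (h \<xi> x))\<^sup>2)) \<partial>(lebesgue \<Otimes>\<^sub>M lebesgue)) < \<infinity>"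
    using kernel_finite by simp
qed measurable

lemma analysis_measurable:
  assumes "u \<in> L2_space"
  shows "analysis u \<in> borel_measurable lebesgue"
proof -
  note [measurable] = L2_measurable[OF assms]
  show ?thesis unfolding analysis_def l2_inner_def by measurable
qed

lemma analysis_bound:
  assumes "u \<in> L2_space"
  shows "(\<integral>\<^sup>+\<xi>. ennreal ((cmod (analysis u \<xi>))\<^sup>2) \<partial>lebesgue) \<le> ennreal (hs_trace * (l2_norm u)\<^sup>2)"
proof -
  have "(\<integral>\<^sup>+\<xi>. ennreal ((cmod (analysis u \<xi>))\<^sup>2) \<partial>lebesgue)
      \<le> (\<integral>\<^sup>+\<xi>. ennreal ((l2_norm u)\<^sup>2) * ennreal ((l2_norm (h \<xi>))\<^sup>2) \<partial>lebesgue)"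
  proof (intro nn_integral_mono)
    fix \<xi>
    have "(cmod (analysis u \<xi>))\<^sup>2 \<le> (l2_norm (h \<xi>) * l2_norm u)\<^sup>2"
      unfolding analysis_def by (intro power_mono l2_Cauchy_Schwarz slice_L2 assms) simp
    then show "ennreal ((cmod (analysis u \<xi>))\<^sup>2) \<le> ennreal ((l2_norm u)\<^sup>2) * ennreal ((l2_norm (h \<xi>))\<^sup>2)"
      by (simp add: ennreal_mult[symmetric] ennreal_leI power_mult_distrib mult.commute)
  qed
  also have "\<dots> = ennreal ((l2_norm u)\<^sup>2) * (\<integral>\<^sup>+\<xi>. ennreal ((l2_norm (h \<xi>))\<^sup>2) \<partial>lebesgue)"
  proof (rule nn_integral_cmult)
    show "(\<lambda>\<xi>. ennreal ((l2_norm (h \<xi>))\<^sup>2)) \<in> borel_measurable lebesgue"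
      unfolding l2_norm_square by measurable
  qed
  also have "\<dots> = ennreal (hs_trace * (l2_norm u)\<^sup>2)"
    unfolding hs_trace_slice by (simp add: ennreal_mult[symmetric] hs_trace_nonneg mult.commute)
  finally show ?thesis .
qed

lemma analysis_L2:
  assumes "u \<in> L2_space"
  shows "analysis u \<in> L2_space"
  unfolding L2_iff_nn_integral
  using analysis_bound[OF assms] analysis_measurable[OF assms]
  by (auto simp: less_top[symmetric] top_unique)

lemma analysis_norm_bound:
  assumes "u \<in> L2_space"
  shows "(l2_norm (analysis u))\<^sup>2 \<le> hs_trace * (l2_norm u)\<^sup>2"
  using analysis_bound[OF assms] l2_norm_square_nn[OF analysis_L2[OF assms]] hs_trace_nonneg
  by (metis ennreal_le_iff mult_nonneg_nonneg zero_le_power2)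

text \<open>Fubini gives square-integrable columns for almost every position. This is why linearity
  of \<open>frame_op\<close> is obtained modulo null sets.\<close>

lemma AE_column_L2: "AE x in lebesgue. (\<lambda>\<xi>. h \<xi> x) \<in> L2_space"
proof -
  have "AE x in lebesgue. integrable lebesgue (\<lambda>\<xi>. (cmod (h \<xi> x))\<^sup>2)"
    using leb_pair.AE_integrable_snd[OF kernel_square_integrable] .
  then show ?thesis by (simp add: L2_space_def)
qed

lemma frame_op_measurable:
  assumes "u \<in> L2_space"
  shows "frame_op u \<in> borel_measurable lebesgue"
proof -
  note [measurable] = analysis_measurable[OF assms]
  show ?thesis unfolding frame_op_def by measurable
qed

lemma frame_op_column:
  "frame_op u x = l2_inner (\<lambda>\<xi>. cnj (h \<xi> x)) (analysis u)"
  by (simp add: frame_op_def l2_inner_def)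

text \<open>Cauchy-Schwarz in frequency bounds each value by the column norm times |A u|;
  integrating the squared column norms over positions returns \<open>hs_trace\<close> by Tonelli,
  and |A u|^2 contributes the second factor \<open>hs_trace\<close>.\<close>

lemma frame_op_bound:
  assumes u: "u \<in> L2_space"
  shows "(\<integral>\<^sup>+x. ennreal ((cmod (frame_op u x))\<^sup>2) \<partial>lebesgue) \<le> ennreal ((hs_trace * l2_norm u)\<^sup>2)"
proof -
  let ?A = "(l2_norm (analysis u))\<^sup>2"
  have "(\<integral>\<^sup>+x. ennreal ((cmod (frame_op u x))\<^sup>2) \<partial>lebesgue)
      \<le> (\<integral>\<^sup>+x. ennreal ?A * (\<integral>\<^sup>+\<xi>. ennreal ((cmod (h \<xi> x))\<^sup>2) \<partial>lebesgue) \<partial>lebesgue)"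
  proof (rule nn_integral_mono_AE, use AE_column_L2 in eventually_elim)
    fix x assume x: "(\<lambda>\<xi>. h \<xi> x) \<in> L2_space"
    have "(cmod (frame_op u x))\<^sup>2 \<le> (l2_norm (\<lambda>\<xi>. cnj (h \<xi> x)) * l2_norm (analysis u))\<^sup>2"
      unfolding frame_op_column
      by (intro power_mono l2_Cauchy_Schwarz L2_cnj[OF x] analysis_L2 u) simp
    also have "\<dots> = ?A * (l2_norm (\<lambda>\<xi>. h \<xi> x))\<^sup>2"
      by (simp add: power_mult_distrib l2_norm_def)
    finally have "ennreal ((cmod (frame_op u x))\<^sup>2) \<le> ennreal ?A * ennreal ((l2_norm (\<lambda>\<xi>. h \<xi> x))\<^sup>2)"
      by (simp add: ennreal_mult[symmetric] ennreal_leI)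
    then show "ennreal ((cmod (frame_op u x))\<^sup>2)
        \<le> ennreal ?A * (\<integral>\<^sup>+\<xi>. ennreal ((cmod (h \<xi> x))\<^sup>2) \<partial>lebesgue)"
      by (simp only: l2_norm_square_nn[OF x])
  qed
  also have "\<dots> = ennreal ?A * (\<integral>\<^sup>+x. (\<integral>\<^sup>+\<xi>. ennreal ((cmod (h \<xi> x))\<^sup>2) \<partial>lebesgue) \<partial>lebesgue)"
    by (rule nn_integral_cmult) measurable
  also have "(\<integral>\<^sup>+x. (\<integral>\<^sup>+\<xi>. ennreal ((cmod (h \<xi> x))\<^sup>2) \<partial>lebesgue) \<partial>lebesgue) = ennreal hs_trace"
    unfolding hs_trace_eq[symmetric] by (rule leb_pair.Fubini') measurable
  also have "ennreal ?A * ennreal hs_trace = ennreal (?A * hs_trace)"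
    by (simp add: ennreal_mult hs_trace_nonneg)
  also have "\<dots> \<le> ennreal ((hs_trace * (l2_norm u)\<^sup>2) * hs_trace)"
    by (intro ennreal_leI mult_right_mono analysis_norm_bound u hs_trace_nonneg)
  also have "(hs_trace * (l2_norm u)\<^sup>2) * hs_trace = (hs_trace * l2_norm u)\<^sup>2"
    by (simp add: power2_eq_square)
  finally show ?thesis .
qed

lemma frame_op_L2:
  assumes "u \<in> L2_space"
  shows "frame_op u \<in> L2_space"
  unfolding L2_iff_nn_integral
  using frame_op_bound[OF assms] frame_op_measurable[OF assms]
  by (auto simp: less_top[symmetric] top_unique)

lemma frame_op_norm_bound:
  assumes "u \<in> L2_space"
  shows "l2_norm (frame_op u) \<le> hs_trace * l2_norm u"
proof (rule power2_le_imp_le)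
  show "(l2_norm (frame_op u))\<^sup>2 \<le> (hs_trace * l2_norm u)\<^sup>2"
    using frame_op_bound[OF assms] l2_norm_square_nn[OF frame_op_L2[OF assms]]
    by (metis ennreal_le_iff zero_le_power2)
qed (simp add: hs_trace_nonneg l2_norm_nonneg)

lemma frame_op_inner:
  assumes w: "w \<in> L2_space" and u: "u \<in> L2_space"
  shows "l2_inner w (frame_op u) = l2_inner (analysis w) (analysis u)"
proof -
  note [measurable] = analysis_measurable[OF u] L2_measurable[OF w]
  let ?G = "\<lambda>\<xi> x. cnj (w x) * (h \<xi> x * analysis u \<xi>)"
  \<comment> \<open>Majorant for Fubini: |w| |h| |A u| \<le> |h|^2 + |w|^2 |A u|^2, the kernel
    square plus a product of integrable functions of separate variables.\<close>
  have dom: "integrable (lebesgue \<Otimes>\<^sub>M lebesgue)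
      (\<lambda>(\<xi>, x). (cmod (h \<xi> x))\<^sup>2 + (cmod (w x))\<^sup>2 * (cmod (analysis u \<xi>))\<^sup>2)"
  proof -
    have "integrable (lebesgue \<Otimes>\<^sub>M lebesgue) (\<lambda>(\<xi>, x). (cmod (analysis u \<xi>))\<^sup>2 * (cmod (w x))\<^sup>2)"
    proof (rule leb_pair.Fubini_integrable)
      show "integrable lebesgue (\<lambda>\<xi>. LINT x|lebesgue.
          norm (case (\<xi>, x) of (\<xi>, x) \<Rightarrow> (cmod (analysis u \<xi>))\<^sup>2 * (cmod (w x))\<^sup>2))"
        using L2_integrable[OF analysis_L2[OF u]] by simp
      show "AE \<xi> in lebesgue. integrable lebesgue
          (\<lambda>x. case (\<xi>, x) of (\<xi>, x) \<Rightarrow> (cmod (analysis u \<xi>))\<^sup>2 * (cmod (w x))\<^sup>2)"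
        using L2_integrable[OF w] by simp
    qed measurable
    from Bochner_Integration.integrable_add[OF kernel_square_integrable this]
    show ?thesis by (simp add: case_prod_unfold mult.commute)
  qed
  have "integrable (lebesgue \<Otimes>\<^sub>M lebesgue) (case_prod ?G)"
  proof (rule Bochner_Integration.integrable_bound[OF dom])
    show "case_prod ?G \<in> borel_measurable (lebesgue \<Otimes>\<^sub>M lebesgue)" by measurable
    have "a * (b * c) \<le> b\<^sup>2 + a\<^sup>2 * c\<^sup>2" if "a \<ge> 0" "b \<ge> 0" "c \<ge> 0" for a b c :: real
    proof -
      have "2 * (b * (a * c)) \<le> b\<^sup>2 + (a * c)\<^sup>2"
        using sum_squares_bound[of b "a * c"] by (simp add: mult.assoc)
      moreover have "0 \<le> b * (a * c)" using that by simp
      ultimately show ?thesis by (simp add: power_mult_distrib algebra_simps)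
    qed
    then show "AE p in lebesgue \<Otimes>\<^sub>M lebesgue. norm (case_prod ?G p)
        \<le> norm (case p of (\<xi>, x) \<Rightarrow> (cmod (h \<xi> x))\<^sup>2 + (cmod (w x))\<^sup>2 * (cmod (analysis u \<xi>))\<^sup>2)"
      by (auto simp: norm_mult split: prod.splits)
  qed
  from leb_pair.Fubini_integral[OF this]
  have "(LINT x|lebesgue. LINT \<xi>|lebesgue. ?G \<xi> x) = (LINT \<xi>|lebesgue. LINT x|lebesgue. ?G \<xi> x)" .
  moreover have "(LINT x|lebesgue. LINT \<xi>|lebesgue. ?G \<xi> x) = l2_inner w (frame_op u)"
    by (simp add: l2_inner_def frame_op_def)
  moreover have "(LINT \<xi>|lebesgue. LINT x|lebesgue. ?G \<xi> x) = l2_inner (analysis w) (analysis u)"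
  proof -
    have "(LINT x|lebesgue. ?G \<xi> x) = cnj (analysis w \<xi>) * analysis u \<xi>" for \<xi>
    proof -
      have "(LINT x|lebesgue. ?G \<xi> x) = l2_inner w (h \<xi>) * analysis u \<xi>"
        unfolding l2_inner_def mult.assoc[symmetric] by simp
      then show ?thesis by (simp add: analysis_def l2_inner_cnj[of w])
    qed
    then show ?thesis by (simp add: l2_inner_def)
  qed
  ultimately show ?thesis by simp
qed

lemma frame_op_nonneg: "nonneg_op frame_op"
  unfolding nonneg_op_def bounded_op_def
proof (intro conjI ballI allI)
  fix f g :: "real^'d \<Rightarrow> complex" and a b
  assume f: "f \<in> L2_space" and g: "g \<in> L2_space"
  have an: "analysis (\<lambda>y. a * f y + b * g y) = (\<lambda>\<xi>. a * analysis f \<xi> + b * analysis g \<xi>)"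
    unfolding analysis_def by (intro ext l2_inner_lin slice_L2 f g)
  show "AE x in lebesgue. frame_op (\<lambda>y. a * f y + b * g y) x = a * frame_op f x + b * frame_op g x"
    using AE_column_L2
  proof eventually_elim
    case (elim x)
    show ?case
      unfolding frame_op_column an
      by (intro l2_inner_lin L2_cnj[OF elim] analysis_L2 f g)
  qed
next
  show "\<exists>M. \<forall>f\<in>L2_space. l2_norm (frame_op f) \<le> M * l2_norm f"
    using frame_op_norm_bound by blast
qed (auto simp: frame_op_L2 frame_op_inner l2_inner_self complex_nonneg_Reals_iff)

lemma frame_op_form:
  assumes "u \<in> L2_space"
  shows "ennreal (Re (l2_inner u (frame_op u)))
    = (\<integral>\<^sup>+\<xi>. ennreal ((cmod (l2_inner (h \<xi>) u))\<^sup>2) \<partial>lebesgue)"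
proof -
  have "Re (l2_inner u (frame_op u)) = (l2_norm (analysis u))\<^sup>2"
    unfolding frame_op_inner[OF assms assms] l2_inner_self by simp
  then show ?thesis
    by (simp add: l2_norm_square_nn[OF analysis_L2[OF assms]]) (simp add: analysis_def)
qed

text \<open>Exchanging the sum with the integral of non-negative terms leaves Bessel's inequality
  for each slice \<open>h \<xi>\<close>.\<close>

lemma trace_sum_bound:
  assumes "orthonormal_basis e"
  shows "(\<Sum>n. \<integral>\<^sup>+\<xi>. ennreal ((cmod (l2_inner (h \<xi>) (e n)))\<^sup>2) \<partial>lebesgue) \<le> ennreal hs_trace"
proof -
  have e: "e n \<in> L2_space" for n using assms by (simp add: orthonormal_basis_def)
  note [measurable] = analysis_measurable[OF e, unfolded analysis_def]
  have "(\<Sum>n. \<integral>\<^sup>+\<xi>. ennreal ((cmod (l2_inner (h \<xi>) (e n)))\<^sup>2) \<partial>lebesgue)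
      = (\<integral>\<^sup>+\<xi>. (\<Sum>n. ennreal ((cmod (l2_inner (h \<xi>) (e n)))\<^sup>2)) \<partial>lebesgue)"
    by (rule nn_integral_suminf[symmetric]) measurable
  also have "\<dots> \<le> (\<integral>\<^sup>+\<xi>. ennreal ((l2_norm (h \<xi>))\<^sup>2) \<partial>lebesgue)"
    by (intro nn_integral_mono Bessel_nn assms slice_L2)
  finally show ?thesis unfolding hs_trace_slice .
qed

end


section \<open>Orthonormalization and polynomials in several variables\<close>

lemma l2_inner_sum_left:
  assumes "h \<in> L2_space" "finite I" "\<And>i. i \<in> I \<Longrightarrow> b i \<in> L2_space"
  shows "l2_inner (\<lambda>x. \<Sum>i\<in>I. c i * b i x) h = (\<Sum>i\<in>I. cnj (c i) * l2_inner (b i) h)"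
proof -
  have "l2_inner (\<lambda>x. \<Sum>i\<in>I. c i * b i x) h = cnj (l2_inner h (\<lambda>x. \<Sum>i\<in>I. c i * b i x))"
    by (rule l2_inner_cnj)
  also have "\<dots> = cnj (\<Sum>i\<in>I. c i * l2_inner h (b i))"
    by (subst l2_inner_sum[OF assms]) auto
  also have "\<dots> = (\<Sum>i\<in>I. cnj (c i) * l2_inner (b i) h)"
    unfolding cnj_sum by (intro sum.cong refl) (simp add: l2_inner_cnj[of _ h])
  finally show ?thesis .
qed

lemma l2_inner_orthonormal_sum:
  fixes q :: "nat \<Rightarrow> real^'d \<Rightarrow> complex"
  assumes q: "\<And>j. j < m \<Longrightarrow> q j \<in> L2_space"
    and orth: "\<And>j k. j < m \<Longrightarrow> k < m \<Longrightarrow> l2_inner (q j) (q k) = (if j = k then 1 else 0)"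
    and k: "k < m"
  shows "l2_inner (q k) (\<lambda>x. \<Sum>j<m. c j * q j x) = c k"
proof -
  have "l2_inner (q k) (\<lambda>x. \<Sum>j<m. c j * q j x) = (\<Sum>j<m. c j * l2_inner (q k) (q j))"
    using k by (intro l2_inner_sum q) auto
  also have "\<dots> = (\<Sum>j<m. if k = j then c j else 0)"
    using k by (intro sum.cong) (auto simp: orth)
  finally show ?thesis using k by simp
qed

text \<open>
  The last two conditions say that the \<open>q j\<close> and the \<open>b i\<close> have the same orthogonal complement;
  the \<open>b i\<close> may be linearly dependent.
\<close>

definition orthonormalizes ::
  "'i set \<Rightarrow> ('i \<Rightarrow> real^'d \<Rightarrow> complex) \<Rightarrow> nat \<Rightarrow> (nat \<Rightarrow> real^'d \<Rightarrow> complex) \<Rightarrow> bool" where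
  "orthonormalizes I b m q \<longleftrightarrow> (\<forall>j<m. q j \<in> L2_space) \<and>
    (\<forall>j<m. \<forall>k<m. l2_inner (q j) (q k) = (if j = k then 1 else 0)) \<and>
    (\<forall>w\<in>L2_space. (\<forall>j<m. l2_inner (q j) w = 0) \<longrightarrow> (\<forall>i\<in>I. l2_inner (b i) w = 0)) \<and>
    (\<forall>w\<in>L2_space. (\<forall>i\<in>I. l2_inner (b i) w = 0) \<longrightarrow> (\<forall>j<m. l2_inner (q j) w = 0))"

lemma orthonormalizesD:
  assumes "orthonormalizes I b m q"
  shows "j < m \<Longrightarrow> q j \<in> L2_space"
    and "j < m \<Longrightarrow> k < m \<Longrightarrow> l2_inner (q j) (q k) = (if j = k then 1 else 0)"
    and "w \<in> L2_space \<Longrightarrow> (\<And>j. j < m \<Longrightarrow> l2_inner (q j) w = 0) \<Longrightarrow> i \<in> I \<Longrightarrow> l2_inner (b i) w = 0"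
    and "w \<in> L2_space \<Longrightarrow> (\<And>i. i \<in> I \<Longrightarrow> l2_inner (b i) w = 0) \<Longrightarrow> j < m \<Longrightarrow> l2_inner (q j) w = 0"
  using assms by (auto simp: orthonormalizes_def)

text \<open>Gram-Schmidt: subtract from the new \<open>b i\<close> its components along the
  \<open>q j\<close>. A residual of norm 0 marks a dependent vector and leaves the system as it is;
  otherwise the residual is normalized and appended.\<close>

lemma ex_orthonormalization:
  fixes b :: "'i \<Rightarrow> real^'d \<Rightarrow> complex"
  assumes "finite I" "\<And>i. i \<in> I \<Longrightarrow> b i \<in> L2_space"
  shows "\<exists>m q. orthonormalizes I b m q"
  using assms
proof (induction I rule: finite_induct)
  case empty
  show ?case by (rule exI[of _ 0]) (simp add: orthonormalizes_def)
next
  case (insert i I)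
  then obtain m q where Q: "orthonormalizes I b m q" by auto
  note q = orthonormalizesD(1)[OF Q] and orth = orthonormalizesD(2)[OF Q]
    and qb = orthonormalizesD(3)[OF Q] and bq = orthonormalizesD(4)[OF Q]
  have bi: "b i \<in> L2_space" using insert.prems by simp
  define p where "p = (\<lambda>x. \<Sum>j<m. l2_inner (q j) (b i) * q j x)"
  define r where "r = (\<lambda>x. b i x - p x)"
  have p: "p \<in> L2_space" unfolding p_def by (intro L2_sum q) auto
  have r: "r \<in> L2_space" unfolding r_def by (intro L2_diff bi p)
  \<comment> \<open>A function orthogonal to the \<open>q j\<close> cannot tell \<open>b i\<close>
    from its residual; this transfers orthogonality in both directions.\<close>
  have rw: "l2_inner r w = l2_inner (b i) w" if "w \<in> L2_space" "\<And>j. j < m \<Longrightarrow> l2_inner (q j) w = 0" for w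
  proof -
    have "l2_inner p w = 0"
      unfolding p_def using that(2) by (subst l2_inner_sum_left[OF that(1)]) (auto simp: q)
    then show ?thesis unfolding r_def using l2_inner_diff_left[OF that(1) bi p] by simp
  qed
  have qr: "l2_inner (q j) r = 0" if "j < m" for j
    unfolding r_def using l2_inner_diff[OF q[OF that] bi p]
      l2_inner_orthonormal_sum[OF q orth that, where c = "\<lambda>j. l2_inner (q j) (b i)"]
    by (simp add: p_def)
  show ?case
  proof (cases "l2_norm r = 0")
    case True
    have "l2_inner (b i) w = 0" if w: "w \<in> L2_space" "\<And>j. j < m \<Longrightarrow> l2_inner (q j) w = 0" for w
      using l2_Cauchy_Schwarz[OF r w(1)] True rw[OF w] by simp
    then show ?thesis
      unfolding orthonormalizes_def
      by (intro exI[of _ m] exI[of _ q] conjI allI impI ballI) (auto simp: orth intro: q qb bq)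
  next
    case False
    define z where "z = (\<lambda>x. complex_of_real (1 / l2_norm r) * r x)"
    have z: "z \<in> L2_space" unfolding z_def by (intro L2_cmult r)
    have zl: "l2_inner z w = of_real (1 / l2_norm r) * l2_inner r w" if "w \<in> L2_space" for w
      using l2_inner_lin_left[OF that r r, of "of_real (1 / l2_norm r)" 0] by (simp add: z_def)
    have zr: "l2_inner w z = of_real (1 / l2_norm r) * l2_inner w r" if "w \<in> L2_space" for w
      unfolding z_def by (intro l2_inner_cmult r that)
    have zz: "l2_inner z z = 1"
      unfolding zl[OF z] zr[OF r] l2_inner_self[of r] using False by (simp add: power2_eq_square)
    have qz: "l2_inner (q j) z = 0" "l2_inner z (q j) = 0" if "j < m" for j
      using qr[OF that] by (simp_all add: zr q that l2_inner_cnj[of z])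
    let ?q = "q(m := z)"
    show ?thesis
      unfolding orthonormalizes_def
    proof (intro exI[of _ "Suc m"] exI[of _ ?q] conjI allI impI ballI)
      fix j assume "j < Suc m"
      then show "?q j \<in> L2_space" using q z by (auto simp: less_Suc_eq)
      fix k assume "k < Suc m"
      with \<open>j < Suc m\<close> show "l2_inner (?q j) (?q k) = (if j = k then 1 else 0)"
        using orth zz qz by (auto simp: less_Suc_eq)
    next
      fix w i' assume w: "w \<in> L2_space" "\<forall>j<Suc m. l2_inner (?q j) w = 0" and i': "i' \<in> insert i I"
      have qw: "l2_inner (q j) w = 0" if "j < m" for j
        using w(2)[rule_format, of j] that by simp
      have "l2_inner z w = 0" using w(2)[rule_format, of m] by simp
      then have "l2_inner r w = 0" using zl[OF w(1)] False by simp
      then have "l2_inner (b i) w = 0" using rw[OF w(1) qw] by simp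
      then show "l2_inner (b i') w = 0" using i' qb[OF w(1) qw] by auto
    next
      fix w j assume w: "w \<in> L2_space" "\<forall>i\<in>insert i I. l2_inner (b i) w = 0" and j: "j < Suc m"
      have qw: "l2_inner (q j) w = 0" if "j < m" for j
        using bq[OF w(1) _ that] w(2) by blast
      have "l2_inner z w = 0"
        using rw[OF w(1) qw] w by (simp add: zl)
      then show "l2_inner (?q j) w = 0" using j qw by (auto simp: less_Suc_eq)
    qed
  qed
qed

section \<open>Polynomials of bounded total degree and the Taylor remainder of the plane
  wave\<close>

text \<open>Each entry is at most the total. Finiteness matters because a sum over an infinite index
  set is 0 by convention.\<close>

lemma finite_multi_index: "finite {\<alpha> :: 'd::finite \<Rightarrow> nat. (\<Sum>j\<in>UNIV. \<alpha> j) \<le> n}"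
proof (rule finite_subset)
  show "{\<alpha> :: 'd \<Rightarrow> nat. (\<Sum>j\<in>UNIV. \<alpha> j) \<le> n}
      \<subseteq> {\<alpha>. \<forall>j. (j \<in> UNIV \<longrightarrow> \<alpha> j \<in> {..n}) \<and> (j \<notin> UNIV \<longrightarrow> \<alpha> j = 0)}"
  proof clarsimp
    fix \<alpha> :: "'d \<Rightarrow> nat" and j assume "(\<Sum>j\<in>UNIV. \<alpha> j) \<le> n"
    moreover have "\<alpha> j \<le> (\<Sum>j\<in>UNIV. \<alpha> j)" by (rule member_le_sum) auto
    ultimately show "\<alpha> j \<le> n" by simp
  qed
  show "finite {\<alpha> :: 'd \<Rightarrow> nat. \<forall>j. (j \<in> UNIV \<longrightarrow> \<alpha> j \<in> {..n}) \<and> (j \<notin> UNIV \<longrightarrow> \<alpha> j = 0)}"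
    by (rule finite_set_of_finite_funs) auto
qed

text \<open>The index set has the form used in \<open>moment_space\<close>, so multiplication by
  \<open>v\<close> turns such a polynomial into an element of that space with the same
  coefficients.\<close>

definition poly_deg_le :: "nat \<Rightarrow> (real^'d::finite \<Rightarrow> complex) \<Rightarrow> bool" where
  "poly_deg_le n p \<longleftrightarrow>
    (\<exists>c. p = (\<lambda>x. \<Sum>\<alpha> | (\<Sum>j\<in>UNIV. \<alpha> j) \<le> n. c \<alpha> * complex_of_real (multi_monom \<alpha> x)))"

lemma poly_deg_le_lin:
  assumes "poly_deg_le n p" "poly_deg_le n r"
  shows "poly_deg_le n (\<lambda>x. a * p x + b * r x)"
proof -
  obtain c c' where c: "p = (\<lambda>x. \<Sum>\<alpha> | (\<Sum>j\<in>UNIV. \<alpha> j) \<le> n. c \<alpha> * complex_of_real (multi_monom \<alpha> x))"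
      "r = (\<lambda>x. \<Sum>\<alpha> | (\<Sum>j\<in>UNIV. \<alpha> j) \<le> n. c' \<alpha> * complex_of_real (multi_monom \<alpha> x))"
    using assms by (auto simp: poly_deg_le_def)
  show ?thesis
    unfolding poly_deg_le_def c
    by (rule exI[of _ "\<lambda>\<alpha>. a * c \<alpha> + b * c' \<alpha>"])
      (simp add: sum_distrib_left sum.distrib[symmetric] algebra_simps)
qed

lemma poly_deg_le_sum:
  assumes "finite I" "\<And>i. i \<in> I \<Longrightarrow> poly_deg_le n (p i)"
  shows "poly_deg_le n (\<lambda>x. \<Sum>i\<in>I. c i * p i x)"
  using assms
proof (induction I rule: finite_induct)
  case empty
  show ?case unfolding poly_deg_le_def by (rule exI[of _ "\<lambda>_. 0"]) simp
next
  case (insert i I)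
  then show ?case
    using poly_deg_le_lin[of n "p i" "\<lambda>x. \<Sum>i\<in>I. c i * p i x" "c i" 1] by simp
qed

lemma poly_deg_le_monom:
  assumes "(\<Sum>j\<in>UNIV. \<alpha> j) \<le> n"
  shows "poly_deg_le n (\<lambda>x. complex_of_real (multi_monom \<alpha> x))"
  unfolding poly_deg_le_def
proof (intro exI[of _ "\<lambda>\<beta>. if \<beta> = \<alpha> then 1 else 0"] ext)
  fix x
  have "(\<Sum>\<beta> | (\<Sum>j\<in>UNIV. \<beta> j) \<le> n. (if \<beta> = \<alpha> then 1 else 0) * complex_of_real (multi_monom \<beta> x))
      = (\<Sum>\<beta> | (\<Sum>j\<in>UNIV. \<beta> j) \<le> n. if \<alpha> = \<beta> then complex_of_real (multi_monom \<beta> x) else 0)"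
    by (intro sum.cong) auto
  also have "\<dots> = complex_of_real (multi_monom \<alpha> x)"
    using assms by (subst sum.delta'[OF finite_multi_index]) simp
  finally show "complex_of_real (multi_monom \<alpha> x) = (\<Sum>\<beta> | (\<Sum>j\<in>UNIV. \<beta> j) \<le> n.
      (if \<beta> = \<alpha> then 1 else 0) * complex_of_real (multi_monom \<beta> x))"
    by simp
qed

lemma multi_monom_Suc:
  fixes \<alpha> :: "'d::finite \<Rightarrow> nat"
  shows "multi_monom (\<alpha>(j := Suc (\<alpha> j))) x = x $ j * multi_monom \<alpha> x"
proof -
  have "(\<Prod>i\<in>UNIV - {j}. (x $ i) ^ (\<alpha>(j := Suc (\<alpha> j))) i) = (\<Prod>i\<in>UNIV - {j}. (x $ i) ^ \<alpha> i)"
    by (intro prod.cong) auto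
  then show ?thesis
    unfolding multi_monom_def
    by (simp add: prod.remove[of UNIV j] del: fun_upd_apply) simp
qed

lemma sum_fun_upd_Suc:
  fixes \<alpha> :: "'d::finite \<Rightarrow> nat"
  shows "(\<Sum>i\<in>UNIV. (\<alpha>(j := Suc (\<alpha> j))) i) = Suc (\<Sum>i\<in>UNIV. \<alpha> i)"
proof -
  have "(\<Sum>i\<in>UNIV - {j}. (\<alpha>(j := Suc (\<alpha> j))) i) = (\<Sum>i\<in>UNIV - {j}. \<alpha> i)"
    by (intro sum.cong) auto
  then show ?thesis
    by (simp add: sum.remove[of UNIV j] del: fun_upd_apply) simp
qed

lemma poly_deg_le_times_coord:
  assumes "poly_deg_le n p"
  shows "poly_deg_le (Suc n) (\<lambda>x. complex_of_real (x $ j) * p x)"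
proof -
  let ?I = "{\<alpha> :: 'd \<Rightarrow> nat. (\<Sum>j\<in>UNIV. \<alpha> j) \<le> n}"
  obtain c where c: "p = (\<lambda>x. \<Sum>\<alpha>\<in>?I. c \<alpha> * complex_of_real (multi_monom \<alpha> x))"
    using assms by (auto simp: poly_deg_le_def)
  have "poly_deg_le (Suc n)
      (\<lambda>x. \<Sum>\<alpha>\<in>?I. c \<alpha> * complex_of_real (multi_monom (\<alpha>(j := Suc (\<alpha> j))) x))"
    by (intro poly_deg_le_sum finite_multi_index poly_deg_le_monom)
      (auto simp only: sum_fun_upd_Suc mem_Collect_eq)
  also have "(\<lambda>x. \<Sum>\<alpha>\<in>?I. c \<alpha> * complex_of_real (multi_monom (\<alpha>(j := Suc (\<alpha> j))) x))
      = (\<lambda>x. complex_of_real (x $ j) * p x)"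
    unfolding c multi_monom_Suc by (simp add: sum_distrib_left algebra_simps)
  finally show ?thesis .
qed

lemma poly_deg_le_mono:
  fixes p :: "real^'d::finite \<Rightarrow> complex"
  assumes "poly_deg_le n p" "n \<le> m"
  shows "poly_deg_le m p"
proof -
  let ?I = "{\<alpha> :: 'd \<Rightarrow> nat. (\<Sum>j\<in>UNIV. \<alpha> j) \<le> n}"
  obtain c where c: "p = (\<lambda>x. \<Sum>\<alpha>\<in>?I. c \<alpha> * complex_of_real (multi_monom \<alpha> x))"
    using assms by (auto simp: poly_deg_le_def)
  show ?thesis unfolding c
    using assms(2) by (intro poly_deg_le_sum finite_multi_index poly_deg_le_monom) auto
qed

text \<open>Induction on k: one more factor x \<bullet> \<xi> is a linear combination of the
  coordinates of x, each raising the degree by one.\<close>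

lemma poly_deg_le_inner_power: "poly_deg_le k (\<lambda>x. complex_of_real (x \<bullet> \<xi>) ^ k)"
proof (induction k)
  case 0
  show ?case
    using poly_deg_le_monom[of "\<lambda>_. 0" 0] by (simp add: multi_monom_def)
next
  case (Suc k)
  have "poly_deg_le (Suc k)
      (\<lambda>x. \<Sum>j\<in>UNIV. of_real (\<xi> $ j) * (complex_of_real (x $ j) * complex_of_real (x \<bullet> \<xi>) ^ k))"
    by (intro poly_deg_le_sum poly_deg_le_times_coord Suc.IH) simp
  also have "(\<lambda>x. \<Sum>j\<in>UNIV. of_real (\<xi> $ j) * (complex_of_real (x $ j) * complex_of_real (x \<bullet> \<xi>) ^ k))
      = (\<lambda>x. complex_of_real (x \<bullet> \<xi>) ^ Suc k)"
    by (simp add: inner_vec_def sum_distrib_left sum_distrib_right algebra_simps)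
  finally show ?case .
qed

lemma poly_deg_le_exp_Taylor:
  "poly_deg_le n (\<lambda>x. \<Sum>k\<le>n. (\<i> * complex_of_real (x \<bullet> \<xi>)) ^ k / fact k)"
proof -
  have "poly_deg_le n (\<lambda>x. \<Sum>k\<in>{..n}. (\<i> ^ k / fact k) * complex_of_real (x \<bullet> \<xi>) ^ k)"
    by (intro poly_deg_le_sum) (auto intro: poly_deg_le_mono[OF poly_deg_le_inner_power])
  then show ?thesis by (simp add: power_mult_distrib)
qed

text \<open>Two remainder bounds are combined: 2|t|^n / n! for large t and |t|^(n+1) / (n+1)! for
  small t. The factorials are dropped and the second bound is doubled, so that both carry the factor
  4 after squaring.\<close>

lemma exp_Taylor_remainder:
  fixes t :: real
  shows "(cmod (cis t - (\<Sum>k\<le>n. (\<i> * complex_of_real t) ^ k / fact k)))\<^sup>2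
    \<le> 4 * (\<bar>t\<bar> ^ (2 * n) * min 1 (t\<^sup>2))"
proof -
  let ?r = "cmod (cis t - (\<Sum>k\<le>n. (\<i> * complex_of_real t) ^ k / fact k))"
  have 1: "?r \<le> 2 * \<bar>t\<bar> ^ n"
  proof -
    have "?r \<le> 2 * \<bar>t\<bar> ^ n / fact n"
      using iexp_approx2[of t n] by (simp add: cis_conv_exp)
    also have "\<dots> \<le> 2 * \<bar>t\<bar> ^ n / 1" by (intro divide_left_mono) (auto simp: fact_ge_1)
    finally show ?thesis by simp
  qed
  have 2: "?r \<le> 2 * \<bar>t\<bar> ^ Suc n"
  proof -
    have "?r \<le> \<bar>t\<bar> ^ Suc n / fact (Suc n)"
      using iexp_approx1[of t n] by (simp add: cis_conv_exp)
    also have "\<dots> \<le> \<bar>t\<bar> ^ Suc n / 1" by (intro divide_left_mono) (auto simp: fact_ge_1 simp del: fact_Suc)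
    also have "\<dots> \<le> 2 * \<bar>t\<bar> ^ Suc n" by simp
    finally show ?thesis .
  qed
  have "?r\<^sup>2 \<le> (2 * \<bar>t\<bar> ^ n)\<^sup>2" "?r\<^sup>2 \<le> (2 * \<bar>t\<bar> ^ Suc n)\<^sup>2"
    by (rule power_mono[OF 1] power_mono[OF 2], simp)+
  moreover have "(2 * \<bar>t\<bar> ^ n)\<^sup>2 = 4 * (\<bar>t\<bar> ^ (2 * n) * 1)"
    by (simp add: power_mult_distrib power_mult mult.commute[of 2] del: power_abs)
  moreover have "(2 * \<bar>t\<bar> ^ Suc n)\<^sup>2 = 4 * (\<bar>t\<bar> ^ (2 * n) * t\<^sup>2)"
  proof -
    have "(2 * \<bar>t\<bar> ^ Suc n)\<^sup>2 = 4 * (\<bar>t\<bar>\<^sup>2 * (\<bar>t\<bar> ^ n)\<^sup>2)"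
      by (simp only: power_mult_distrib power_Suc) simp
    also have "(\<bar>t\<bar> ^ n)\<^sup>2 = \<bar>t\<bar> ^ (2 * n)"
      by (simp only: power_mult[symmetric] mult.commute)
    finally show ?thesis by (simp only: power2_abs mult.commute mult.left_commute)
  qed
  ultimately have "?r\<^sup>2 \<le> 4 * (\<bar>t\<bar> ^ (2 * n) * 1)" "?r\<^sup>2 \<le> 4 * (\<bar>t\<bar> ^ (2 * n) * t\<^sup>2)"
    by (simp_all only:)
  then show ?thesis by (cases "1 \<le> t\<^sup>2") (simp_all only: min_def if_True if_False)
qed


section \<open>The dyadic integral over low frequencies\<close>

text \<open>The terms are B^k min(1, (L/2^k)^2) with B = 2^a and 1 \<le> B < 4. Below K = floor(log2
  L) the minimum is bounded by 1, and the B^k sum to a multiple of B^K \<le> L^a, or to K if a = 0;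
  from K on the terms are dominated by a geometric series of ratio B/4.\<close>

lemma dyadic_sum_bound:
  fixes a :: real
  assumes a: "0 \<le> a" "a < 2"
  obtains C where "C > 0"
    "\<And>L. L \<ge> 1 \<Longrightarrow> (\<Sum>k. ennreal (((1/2) ^ k) powr (- a) * min 1 ((L * (1/2) ^ k)\<^sup>2)))
      \<le> ennreal (C * (L powr a * (if a = 0 then 1 + ln L else 1)))"
proof
  define B where "B = 2 powr a"
  have B1: "B \<ge> 1" using a by (simp add: B_def ge_one_powr_ge_zero)
  have "B < 2 powr 2" unfolding B_def using a by (intro powr_less_mono) auto
  then have B4: "B < 4" by simp
  \<comment> \<open>Tail constant plus head constant. The 4 in the numerator comes from squaring L <
    2 * 2^K.\<close>
  define C where "C = 4 / (1 - B / 4) + (if a = 0 then 1 / ln 2 else 1 / (B - 1))"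
  have B1': "B > 1" if "a \<noteq> 0" unfolding B_def using a that by (simp add: gr_one_powr)
  have pos: "4 / (1 - B / 4) > 0" using B4 by simp
  moreover have nn: "(if a = 0 then 1 / ln 2 else 1 / (B - 1)) \<ge> 0" using B1' by auto
  ultimately show "C > 0" unfolding C_def by linarith
  fix L :: real assume L: "L \<ge> 1"
  define W where "W = L powr a * (if a = 0 then 1 + ln L else 1)"
  define K where "K = nat \<lfloor>log 2 L\<rfloor>"
  have logL: "log 2 L \<ge> 0" using L by simp
  then have K: "real K \<le> log 2 L" "log 2 L < real K + 1"
    unfolding K_def by (simp, linarith)
  have "2 powr real K \<le> 2 powr log 2 L" using K by (intro powr_mono) auto
  then have K1: "2 ^ K \<le> L" using L by (simp add: powr_realpow)
  have "2 powr log 2 L < 2 powr (real K + 1)" using K by (intro powr_less_mono) auto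
  then have K2: "L < 2 * 2 ^ K" using L by (simp add: powr_realpow powr_add)
  have r: "((1/2) ^ k) powr (- a) = B ^ k" for k :: nat
  proof -
    have "((1/2::real) ^ k) = 2 powr (- real k)"
      by (simp add: powr_minus powr_realpow power_one_over field_simps)
    then have "((1/2) ^ k) powr (- a) = 2 powr (a * real k)"
      by (simp add: powr_powr mult.commute)
    also have "\<dots> = B ^ k" unfolding B_def by (simp add: powr_power mult.commute)
    finally show ?thesis .
  qed
  have BK: "B ^ K \<le> L powr a"
  proof -
    have "B ^ K = (2 ^ K) powr a"
      unfolding B_def by (simp add: powr_power powr_powr mult.commute flip: powr_realpow)
    also have "\<dots> \<le> L powr a" using K1 a by (intro powr_mono2) auto
    finally show ?thesis .
  qed
  have W1: "L powr a \<le> W" unfolding W_def using L by auto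
  define f where "f = (\<lambda>k. B ^ k * min 1 ((L * (1/2) ^ k)\<^sup>2))"
  have f0: "f k \<ge> 0" for k unfolding f_def using B1 by simp
  have head: "(\<Sum>k<K. f k) \<le> (if a = 0 then 1 / ln 2 else 1 / (B - 1)) * W"
  proof -
    have "(\<Sum>k<K. f k) \<le> (\<Sum>k<K. B ^ k)"
    proof (rule sum_mono)
      fix k
      have "f k \<le> B ^ k * 1" unfolding f_def using B1 by (intro mult_left_mono) auto
      then show "f k \<le> B ^ k" by simp
    qed
    also have "\<dots> \<le> (if a = 0 then 1 / ln 2 else 1 / (B - 1)) * W"
    proof (cases "a = 0")
      case True
      then have "(\<Sum>k<K. B ^ k) = real K" by (simp add: B_def)
      also have "\<dots> \<le> ln L / ln 2" using K(1) by (simp add: log_def)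
      also have "\<dots> \<le> 1 / ln 2 * W" using True L by (simp add: W_def divide_right_mono)
      finally show ?thesis using True by simp
    next
      case False
      then have "(\<Sum>k<K. B ^ k) = (B ^ K - 1) / (B - 1)"
        using B1'[OF False] by (intro geometric_sum) simp
      also have "\<dots> \<le> W / (B - 1)"
        using B1'[OF False] BK W1 by (intro divide_right_mono) auto
      finally show ?thesis using False by simp
    qed
    finally show ?thesis .
  qed
  have tail: "(\<Sum>k. ennreal (f (k + K))) \<le> ennreal (4 / (1 - B / 4) * W)"
  proof -
    have le: "f (k + K) \<le> 4 * B ^ K * (B / 4) ^ k" for k
    proof -
      have "L * (1/2) ^ (k + K) \<le> 2 * 2 ^ K * (1/2) ^ (k + K)"
        using K2 by (intro mult_right_mono) auto
      also have "\<dots> = 2 * (1/2) ^ k" by (simp add: power_add power_one_over)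
      finally have "(L * (1/2) ^ (k + K))\<^sup>2 \<le> (2 * (1/2) ^ k)\<^sup>2"
        using L by (intro power_mono) auto
      also have "\<dots> = 4 * ((1/2)\<^sup>2) ^ k"
        by (simp only: power_mult_distrib power_mult[symmetric] mult.commute) simp
      also have "\<dots> = 4 * (1/4) ^ k" by (simp add: power2_eq_square)
      finally have "min 1 ((L * (1/2) ^ (k + K))\<^sup>2) \<le> 4 * (1/4) ^ k" by simp
      then have "f (k + K) \<le> B ^ (k + K) * (4 * (1/4) ^ k)"
        unfolding f_def using B1 by (intro mult_left_mono) auto
      also have "\<dots> = 4 * B ^ K * (B / 4) ^ k" by (simp add: power_add power_divide)
      finally show ?thesis .
    qed
    have "(\<lambda>k. 4 * B ^ K * (B / 4) ^ k) sums (4 * B ^ K * (1 / (1 - B / 4)))"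
      using B1 B4 by (intro sums_mult geometric_sums) auto
    then have "(\<Sum>k. ennreal (4 * B ^ K * (B / 4) ^ k)) = ennreal (4 * B ^ K * (1 / (1 - B / 4)))"
      using B1 by (intro suminf_ennreal_eq) auto
    moreover have "(\<Sum>k. ennreal (f (k + K))) \<le> (\<Sum>k. ennreal (4 * B ^ K * (B / 4) ^ k))"
      by (intro suminf_le ennreal_leI le) auto
    moreover have "4 * B ^ K * (1 / (1 - B / 4)) = 4 / (1 - B / 4) * B ^ K" by simp
    moreover have "\<dots> \<le> 4 / (1 - B / 4) * W"
      using BK W1 pos by (intro mult_left_mono) auto
    ultimately show ?thesis by (metis (no_types, lifting) ennreal_leI order_trans)
  qed
  have "(\<Sum>k. ennreal (f k)) = (\<Sum>k. ennreal (f (k + K))) + (\<Sum>k<K. ennreal (f k))"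
    by (intro suminf_offset) auto
  also have "(\<Sum>k<K. ennreal (f k)) = ennreal (\<Sum>k<K. f k)"
    using f0 by (intro sum_ennreal) auto
  also have "(\<Sum>k. ennreal (f (k + K))) + ennreal (\<Sum>k<K. f k)
      \<le> ennreal (4 / (1 - B / 4) * W) + ennreal ((if a = 0 then 1 / ln 2 else 1 / (B - 1)) * W)"
    by (intro add_mono tail ennreal_leI head)
  also have "\<dots> = ennreal (4 / (1 - B / 4) * W + (if a = 0 then 1 / ln 2 else 1 / (B - 1)) * W)"
  proof (rule ennreal_plus[symmetric])
    have "W \<ge> 0" using W1 by (meson order_trans powr_ge_zero)
    then show "0 \<le> 4 / (1 - B / 4) * W" "0 \<le> (if a = 0 then 1 / ln 2 else 1 / (B - 1)) * W"
      using pos nn by (auto intro: mult_nonneg_nonneg simp del: times_divide_eq_left)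
  qed
  also have "4 / (1 - B / 4) * W + (if a = 0 then 1 / ln 2 else 1 / (B - 1)) * W = C * W"
    unfolding C_def by (simp only: distrib_right)
  finally show "(\<Sum>k. ennreal (((1/2) ^ k) powr (- a) * min 1 ((L * (1/2) ^ k)\<^sup>2)))
      \<le> ennreal (C * (L powr a * (if a = 0 then 1 + ln L else 1)))"
    unfolding f_def r W_def .
qed

lemma term_le_suminf:
  fixes f :: "nat \<Rightarrow> ennreal"
  shows "f k \<le> (\<Sum>k. f k)"
  using sum_le_suminf[OF summableI, of "{k}" f] by simp

lemma emeasure_lebesgue_ball:
  "r \<ge> 0 \<Longrightarrow> emeasure lebesgue (ball (0 :: real^'d::finite) r)
    = ennreal (unit_ball_vol (real CARD('d)) * r ^ CARD('d))"
  by (simp add: emeasure_ball)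

text \<open>On the shell 2^(-k-1) \<le> |\<xi>| < 2^(-k) the integrand is at most a constant
  \<open>A k\<close>. Enlarging the shell to the ball of radius 2^(-k) costs a constant factor and
  makes the volume explicit, which leaves the dyadic sum.\<close>

lemma low_frequency_integral_bound:
  fixes s :: real and n :: nat
  assumes n: "real n \<le> s - real CARD('d::finite) / 2" "s - real CARD('d) / 2 < real n + 1"
  obtains C where "C > 0"
    "\<And>L. L \<ge> 1 \<Longrightarrow> (\<integral>\<^sup>+\<xi>\<in>ball (0 :: real^'d) 1. ennreal (norm \<xi> powr (- 2 * s) * (L * norm \<xi>) ^ (2 * n)
        * min 1 ((L * norm \<xi>)\<^sup>2)) \<partial>lebesgue)
      \<le> ennreal (C * (L powr (2 * s - real CARD('d))
          * (if s - real CARD('d) / 2 = real n then 1 + ln L else 1)))"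
proof -
  define d where "d = CARD('d)"
  \<comment> \<open>The exponent left on the ball of radius r: r^(-2s) r^(2n) r^d = r^(-a). The
    choice of n amounts to 0 \<le> a < 2.\<close>
  define a where "a = 2 * s - real d - 2 * real n"
  have a: "0 \<le> a" "a < 2" using n by (auto simp: a_def d_def)
  have s: "s \<ge> 0" using n(1) by (smt (verit) divide_nonneg_nonneg of_nat_0_le_iff)
  obtain C0 where C0: "C0 > 0"
    "\<And>L. L \<ge> 1 \<Longrightarrow> (\<Sum>k. ennreal (((1/2) ^ k) powr (- a) * min 1 ((L * (1/2) ^ k)\<^sup>2)))
      \<le> ennreal (C0 * (L powr a * (if a = 0 then 1 + ln L else 1)))"
    using dyadic_sum_bound[OF a] by blast
  define w where "w = unit_ball_vol (real d)"
  have w: "w > 0" by (simp add: w_def)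
  show ?thesis
  proof (rule that[of "2 powr (2 * s) * w * C0"])
    show "2 powr (2 * s) * w * C0 > 0" using C0 w by simp
    fix L :: real assume L: "L \<ge> 1"
    define F where "F = (\<lambda>\<xi> :: real^'d. norm \<xi> powr (- 2 * s) * (L * norm \<xi>) ^ (2 * n)
        * min 1 ((L * norm \<xi>)\<^sup>2))"
    \<comment> \<open>The decreasing factor is taken at the inner radius, hence
      \<open>Suc k\<close>; the increasing ones at the outer radius.\<close>
    define A where "A = (\<lambda>k :: nat. ((1/2) ^ Suc k) powr (- 2 * s) * (L * (1/2) ^ k) ^ (2 * n)
        * min 1 ((L * (1/2) ^ k)\<^sup>2))"
    have A0: "A k \<ge> 0" for k using L by (simp add: A_def)
    have pointwise: "ennreal (F \<xi>) * indicator (ball 0 1) \<xi>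
        \<le> (\<Sum>k. ennreal (A k) * indicator (ball 0 ((1/2) ^ k)) \<xi>)" for \<xi> :: "real^'d"
    proof (cases "\<xi> \<in> ball 0 1 \<and> \<xi> \<noteq> 0")
      case False
      \<comment> \<open>At \<xi> = 0 the convention \<open>0 powr _ = 0\<close> makes the left side
        vanish.\<close>
      then show ?thesis by (cases "\<xi> = 0") (auto simp: F_def)
    next
      case True
      then have xi: "norm \<xi> < 1" "norm \<xi> > 0" by auto
      have ex: "\<exists>k. (1/2) ^ Suc k \<le> norm \<xi>"
      proof -
        obtain m where "(1/2) ^ m < norm \<xi>" using real_arch_pow_inv[of "norm \<xi>" "1/2"] xi by auto
        moreover have "(1/2) ^ Suc m \<le> (1/2::real) ^ m" by simp
        ultimately show ?thesis by (meson less_imp_le order_trans)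
      qed
      \<comment> \<open>The least such index is the shell of \<xi>: its minimality is the strict
        upper bound \<open>k2\<close>.\<close>
      define k where "k = (LEAST k. (1/2) ^ Suc k \<le> norm \<xi>)"
      have k1: "(1/2) ^ Suc k \<le> norm \<xi>" unfolding k_def by (rule LeastI_ex[OF ex])
      have k2: "norm \<xi> < (1/2) ^ k"
      proof (cases k)
        case (Suc j)
        then have "\<not> (1/2) ^ Suc j \<le> norm \<xi>" unfolding k_def by (metis lessI not_less_Least)
        then show ?thesis using Suc by simp
      qed (use xi in simp)
      have "norm \<xi> powr (- 2 * s) \<le> ((1/2) ^ Suc k) powr (- 2 * s)"
        using k1 s by (intro powr_mono2') auto
      moreover have "(L * norm \<xi>) ^ (2 * n) \<le> (L * (1/2) ^ k) ^ (2 * n)"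
        using k2 L by (intro power_mono mult_left_mono) auto
      moreover have "min 1 ((L * norm \<xi>)\<^sup>2) \<le> min 1 ((L * (1/2) ^ k)\<^sup>2)"
        using k2 L by (intro min.mono power_mono mult_left_mono) auto
      ultimately have "F \<xi> \<le> A k"
        unfolding F_def A_def using L by (intro mult_mono) auto
      then have "ennreal (F \<xi>) * indicator (ball 0 1) \<xi> \<le> ennreal (A k) * indicator (ball 0 ((1/2) ^ k)) \<xi>"
        using True k2 by (simp add: ennreal_leI)
      also have "\<dots> \<le> (\<Sum>k. ennreal (A k) * indicator (ball 0 ((1/2) ^ k)) \<xi>)"
        by (rule term_le_suminf)
      finally show ?thesis .
    qed
    have shell: "A k * (w * ((1/2) ^ k) ^ d)
        = 2 powr (2 * s) * w * L ^ (2 * n) * (((1/2) ^ k) powr (- a) * min 1 ((L * (1/2) ^ k)\<^sup>2))" for k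
    proof -
      define r where "r = (1/2::real) ^ k"
      have r: "r > 0" by (simp add: r_def)
      have "((1/2) ^ Suc k) powr (- 2 * s) = (1/2 * r) powr (- 2 * s)" by (simp add: r_def)
      also have "\<dots> = (1/2) powr (- 2 * s) * r powr (- 2 * s)"
        using r by (subst powr_mult) auto
      also have "(1/2::real) powr (- 2 * s) = 2 powr (2 * s)"
        by (simp add: powr_minus powr_divide field_simps)
      finally have 1: "((1/2) ^ Suc k) powr (- 2 * s) = 2 powr (2 * s) * r powr (- 2 * s)" .
      have "r powr (- a) = r powr (- 2 * s) * r powr (real (2 * n)) * r powr real d"
        unfolding powr_add[symmetric] a_def by (simp add: algebra_simps)
      then have 2: "r powr (- a) = r powr (- 2 * s) * r ^ (2 * n) * r ^ d"
        using r by (simp only: powr_realpow)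
      show ?thesis
        unfolding A_def 1 unfolding r_def[symmetric] 2 power_mult_distrib[of L r "2 * n"]
        by (simp only: mult_ac)
    qed
    have "(\<integral>\<^sup>+\<xi>\<in>ball 0 1. ennreal (F \<xi>) \<partial>lebesgue)
        \<le> (\<integral>\<^sup>+\<xi>. (\<Sum>k. ennreal (A k) * indicator (ball (0 :: real^'d) ((1/2) ^ k)) \<xi>) \<partial>lebesgue)"
      by (intro nn_integral_mono pointwise)
    also have "\<dots> = (\<Sum>k. \<integral>\<^sup>+\<xi>. ennreal (A k) * indicator (ball (0 :: real^'d) ((1/2) ^ k)) \<xi> \<partial>lebesgue)"
      by (intro nn_integral_suminf borel_measurable_times_ennreal borel_measurable_indicator) auto
    also have "\<dots> = (\<Sum>k. ennreal (A k * (w * ((1/2) ^ k) ^ d)))"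
    proof (intro arg_cong[where f = suminf] ext)
      fix k
      have "(\<integral>\<^sup>+\<xi>. ennreal (A k) * indicator (ball (0 :: real^'d) ((1/2) ^ k)) \<xi> \<partial>lebesgue)
          = ennreal (A k) * emeasure lebesgue (ball (0 :: real^'d) ((1/2) ^ k))"
        by (intro nn_integral_cmult_indicator) auto
      also have "\<dots> = ennreal (A k) * ennreal (w * ((1/2) ^ k) ^ d)"
        by (subst emeasure_lebesgue_ball) (auto simp: w_def d_def)
      also have "\<dots> = ennreal (A k * (w * ((1/2) ^ k) ^ d))"
        by (intro ennreal_mult[symmetric] A0) (use w in simp)
      finally show "(\<integral>\<^sup>+\<xi>. ennreal (A k) * indicator (ball (0 :: real^'d) ((1/2) ^ k)) \<xi> \<partial>lebesgue)
          = ennreal (A k * (w * ((1/2) ^ k) ^ d))" .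
    qed
    also have "\<dots> = (\<Sum>k. ennreal (2 powr (2 * s) * w * L ^ (2 * n))
        * ennreal (((1/2) ^ k) powr (- a) * min 1 ((L * (1/2) ^ k)\<^sup>2)))"
      unfolding shell using w L by (subst ennreal_mult) auto
    also have "\<dots> = ennreal (2 powr (2 * s) * w * L ^ (2 * n))
        * (\<Sum>k. ennreal (((1/2) ^ k) powr (- a) * min 1 ((L * (1/2) ^ k)\<^sup>2)))"
      by (rule ennreal_suminf_cmult)
    also have "\<dots> \<le> ennreal (2 powr (2 * s) * w * L ^ (2 * n))
        * ennreal (C0 * (L powr a * (if a = 0 then 1 + ln L else 1)))"
      by (intro mult_left_mono C0 L) auto
    also have "\<dots> = ennreal (2 powr (2 * s) * w * L ^ (2 * n)
        * (C0 * (L powr a * (if a = 0 then 1 + ln L else 1))))"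
      using L C0 w by (intro ennreal_mult[symmetric]) auto
    also have "2 powr (2 * s) * w * L ^ (2 * n) * (C0 * (L powr a * (if a = 0 then 1 + ln L else 1)))
        = 2 powr (2 * s) * w * C0 * (L powr (2 * s - real CARD('d))
          * (if s - real CARD('d) / 2 = real n then 1 + ln L else 1))"
    proof -
      \<comment> \<open>The factor L^(2n), common to all shells, restores the exponent: 2n + a = 2s
        - d.\<close>
      have "L powr (2 * s - real d) = L powr (real (2 * n)) * L powr a"
        unfolding powr_add[symmetric] by (simp add: a_def)
      then have "L powr (2 * s - real d) = L ^ (2 * n) * L powr a"
        using L by (simp only: powr_realpow)
      moreover have "a = 0 \<longleftrightarrow> s - real CARD('d) / 2 = real n"
        by (auto simp: a_def d_def field_simps)
      ultimately show ?thesis by (simp only: d_def mult_ac)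
    qed
    finally show "(\<integral>\<^sup>+\<xi>\<in>ball (0 :: real^'d) 1. ennreal (norm \<xi> powr (- 2 * s) * (L * norm \<xi>) ^ (2 * n)
        * min 1 ((L * norm \<xi>)\<^sup>2)) \<partial>lebesgue)
      \<le> ennreal (2 powr (2 * s) * w * C0 * (L powr (2 * s - real CARD('d))
          * (if s - real CARD('d) / 2 = real n then 1 + ln L else 1)))"
      unfolding F_def .
  qed
qed


section \<open>The low-frequency Birman--Schwinger operator\<close>

text \<open>Composition with this identity carries Borel functions over to the completed
  measure.\<close>

lemma ident_borel_lebesgue: "(\<lambda>x. x) \<in> borel_measurable (lebesgue :: 'a::euclidean_space measure)"
  by (intro measurable_completion) simp

lemma borel_measurable_norm_lebesgue [measurable]:
  "norm \<in> borel_measurable (lebesgue :: 'a::euclidean_space measure)"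
  by (rule measurable_compose[OF ident_borel_lebesgue borel_measurable_norm])

lemma borel_measurable_lebesgue_fst:
  fixes f :: "'a::euclidean_space \<Rightarrow> 'c::topological_space"
  shows "f \<in> borel_measurable lebesgue \<Longrightarrow> (\<lambda>p. f (fst p)) \<in> borel_measurable (lebesgue \<Otimes>\<^sub>M M)"
  by (rule measurable_compose[OF measurable_fst])

lemma borel_measurable_lebesgue_snd:
  fixes f :: "'a::euclidean_space \<Rightarrow> 'c::topological_space"
  shows "f \<in> borel_measurable lebesgue \<Longrightarrow> (\<lambda>p. f (snd p)) \<in> borel_measurable (M \<Otimes>\<^sub>M lebesgue)"
  by (rule measurable_compose[OF measurable_snd])

lemma borel_measurable_japanese_bracket [measurable]:
  "japanese_bracket \<in> borel_measurable lebesgue"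
  unfolding japanese_bracket_def by measurable

lemma borel_measurable_multi_monom [measurable]:
  "multi_monom \<alpha> \<in> borel_measurable lebesgue"
proof -
  have "continuous_on UNIV (multi_monom \<alpha>)"
    unfolding multi_monom_def by (intro continuous_intros)
  then show ?thesis
    by (intro measurable_completion) (simp add: borel_measurable_continuous_onI)
qed

lemma borel_measurable_cis [measurable]:
  assumes "f \<in> borel_measurable M"
  shows "(\<lambda>x. cis (f x)) \<in> borel_measurable M"
  using borel_measurable_continuous_on[OF continuous_on_cis[OF continuous_on_id] assms] by simp

lemma borel_measurable_plane_wave [measurable]:
  "(\<lambda>x :: real^'d. cis (x \<bullet> \<xi>)) \<in> borel_measurable lebesgue"
  by (intro borel_measurable_cis borel_measurable_inner ident_borel_lebesgue borel_measurable_const)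

lemma borel_measurable_plane_wave_pair [measurable]:
  "(\<lambda>p. cis (snd p \<bullet> (fst p :: real^'d))) \<in> borel_measurable (lebesgue \<Otimes>\<^sub>M lebesgue)"
  by (intro borel_measurable_cis borel_measurable_inner ident_borel_lebesgue
      borel_measurable_lebesgue_fst[OF ident_borel_lebesgue]
      borel_measurable_lebesgue_snd[OF ident_borel_lebesgue])

lemma japanese_bracket_ge: "japanese_bracket x \<ge> 1" "japanese_bracket x \<ge> norm x"
  unfolding japanese_bracket_def by (auto intro: real_le_rsqrt)

lemma multi_monom_bound: "\<bar>multi_monom \<alpha> x\<bar> \<le> japanese_bracket x ^ (\<Sum>j\<in>UNIV. \<alpha> j)"
proof -
  have "\<bar>multi_monom \<alpha> x\<bar> = (\<Prod>j\<in>UNIV. \<bar>x $ j\<bar> ^ \<alpha> j)"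
    by (simp add: multi_monom_def abs_prod power_abs)
  also have "\<dots> \<le> (\<Prod>j\<in>UNIV. japanese_bracket x ^ \<alpha> j)"
  proof (rule prod_mono)
    fix j
    have "\<bar>x $ j\<bar> \<le> japanese_bracket x"
      using component_le_norm_cart[of x j] japanese_bracket_ge(2)[of x] by linarith
    then show "0 \<le> \<bar>x $ j\<bar> ^ \<alpha> j \<and> \<bar>x $ j\<bar> ^ \<alpha> j \<le> japanese_bracket x ^ \<alpha> j"
      by (simp add: power_mono)
  qed
  also have "\<dots> = japanese_bracket x ^ (\<Sum>j\<in>UNIV. \<alpha> j)"
    by (simp add: power_sum)
  finally show ?thesis .
qed

section \<open>Weight and moment space for a fixed potential\<close>

locale bs_low =
  fixes s E :: real and v :: "real^'d::finite \<Rightarrow> real"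
  assumes s_ge: "s \<ge> real CARD('d) / 2"
    and E_nonpos: "E \<le> 0"
    and v_measurable [measurable]: "v \<in> borel_measurable lebesgue"
    and v_nonneg: "0 \<le> v x"
    and weighted_L2: "(\<lambda>x. complex_of_real (bs_weight s x * v x)) \<in> L2_space"
begin

definition n :: nat where "n = nat \<lfloor>s - real CARD('d) / 2\<rfloor>"

definition I :: "('d \<Rightarrow> nat) set" where "I = {\<alpha>. (\<Sum>j\<in>UNIV. \<alpha> j) \<le> n}"

definition b :: "('d \<Rightarrow> nat) \<Rightarrow> real^'d \<Rightarrow> complex" where
  "b \<alpha> = (\<lambda>x. complex_of_real (multi_monom \<alpha> x * v x))"

text \<open>Since \<open>l2_inner\<close> conjugates its first argument, the phase has the sign
  opposite to that in \<open>fourier\<close>.\<close>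

definition g :: "real^'d \<Rightarrow> real^'d \<Rightarrow> complex" where
  "g \<xi> = (\<lambda>x. cis (x \<bullet> \<xi>) * complex_of_real (v x))"

lemma n_le: "real n \<le> s - real CARD('d) / 2" and n_gt: "s - real CARD('d) / 2 < real n + 1"
  using s_ge unfolding n_def by (simp, linarith)

lemma finite_I: "finite I"
  unfolding I_def by (rule finite_multi_index)

text \<open>\<open>bs_weight\<close> asks for membership in \<open>\<nat>\<close>, the dyadic bound
  for equality with n; these agree because n \<le> s - d/2 < n + 1.\<close>

lemma in_Nats_iff: "s - real CARD('d) / 2 \<in> \<nat> \<longleftrightarrow> s - real CARD('d) / 2 = real n"
proof
  assume "s - real CARD('d) / 2 \<in> \<nat>"
  then obtain k :: nat where "s - real CARD('d) / 2 = real k" by (auto elim: Nats_cases)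
  then show "s - real CARD('d) / 2 = real n" using n_le n_gt by simp
qed (simp only: of_nat_in_Nats)

text \<open>The right side is the dependence on L in \<open>low_frequency_integral_bound\<close> at
  L = <x>; this is where the weight of the theorem comes from.\<close>

lemma weight_square:
  fixes x :: "real^'d"
  shows
  "(bs_weight s x)\<^sup>2 = japanese_bracket x powr (2 * s - real CARD('d))
    * (if s - real CARD('d) / 2 = real n then 1 + ln (japanese_bracket x) else 1)"
proof -
  have "(japanese_bracket x powr (s - real CARD('d) / 2))\<^sup>2 = japanese_bracket x powr (2 * s - real CARD('d))"
  proof -
    have "(s - real CARD('d) / 2) + (s - real CARD('d) / 2) = 2 * s - real CARD('d)" by simp
    then show ?thesis unfolding power2_eq_square powr_add[symmetric] by (simp only:)
  qed
  moreover have "(sqrt (1 + ln (japanese_bracket x)))\<^sup>2 = 1 + ln (japanese_bracket x)"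
    using ln_ge_zero[OF japanese_bracket_ge(1)[of x]] by simp
  moreover have "(bs_weight s x)\<^sup>2 = (japanese_bracket x powr (s - real CARD('d) / 2))\<^sup>2
      * (if s - real CARD('d) / 2 \<in> \<nat> then (sqrt (1 + ln (japanese_bracket x)))\<^sup>2 else 1)"
    unfolding bs_weight_def by (simp only: power_mult_distrib mult_1_right split: if_split) blast
  ultimately show ?thesis by (simp only: in_Nats_iff)
qed

text \<open>Together with \<open>multi_monom_bound\<close> this puts x^\<alpha> v into
  \<open>L2_space\<close> for |\<alpha>| \<le> n.\<close>

lemma weight_ge:
  fixes x :: "real^'d"
  shows "japanese_bracket x ^ n \<le> bs_weight s x"
proof -
  have L: "japanese_bracket x \<ge> 1" by (rule japanese_bracket_ge)
  have "japanese_bracket x ^ n = japanese_bracket x powr real n"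
    using L by (intro powr_realpow[symmetric]) linarith
  also have "\<dots> \<le> japanese_bracket x powr (s - real CARD('d) / 2)"
    using L n_le by (intro powr_mono)
  also have "\<dots> \<le> bs_weight s x"
  proof -
    have "1 \<le> sqrt (1 + ln (japanese_bracket x))"
      using ln_ge_zero[OF L] by simp
    then have "japanese_bracket x powr (s - real CARD('d) / 2) * 1
        \<le> japanese_bracket x powr (s - real CARD('d) / 2) * sqrt (1 + ln (japanese_bracket x))"
      by (intro mult_left_mono) auto
    then show ?thesis by (simp add: bs_weight_def)
  qed
  finally show ?thesis .
qed

lemma b_L2:
  assumes "\<alpha> \<in> I"
  shows "b \<alpha> \<in> L2_space"
proof (rule L2_bound[OF _ L2_integrable[OF weighted_L2]])
  show "b \<alpha> \<in> borel_measurable lebesgue" unfolding b_def by measurable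
  fix x
  have "\<bar>multi_monom \<alpha> x\<bar> \<le> japanese_bracket x ^ (\<Sum>j\<in>UNIV. \<alpha> j)"
    by (rule multi_monom_bound)
  also have "\<dots> \<le> japanese_bracket x ^ n"
    using assms japanese_bracket_ge(1)[of x] by (intro power_increasing) (auto simp: I_def)
  also have "\<dots> \<le> bs_weight s x" by (rule weight_ge)
  finally have "\<bar>multi_monom \<alpha> x\<bar> * v x \<le> bs_weight s x * v x"
    by (rule mult_right_mono) (rule v_nonneg)
  also have "\<dots> \<le> \<bar>bs_weight s x * v x\<bar>" by (rule abs_ge_self)
  finally have "cmod (b \<alpha> x) \<le> cmod (complex_of_real (bs_weight s x * v x))"
    using v_nonneg[of x] unfolding b_def norm_of_real by (simp add: abs_mult)
  then show "(cmod (b \<alpha> x))\<^sup>2 \<le> (cmod (complex_of_real (bs_weight s x * v x)))\<^sup>2"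
    by (intro power_mono) auto
qed

lemma g_L2: "g \<xi> \<in> L2_space"
proof -
  \<comment> \<open>The zero multi-index gives v itself, and |g| = v.\<close>
  have "b (\<lambda>_. 0) \<in> L2_space" by (intro b_L2) (simp add: I_def)
  then have "integrable lebesgue (\<lambda>x. (cmod (g \<xi> x))\<^sup>2)"
    by (simp add: b_def g_def L2_space_def norm_mult multi_monom_def)
  moreover have "g \<xi> \<in> borel_measurable lebesgue" unfolding g_def by measurable
  ultimately show ?thesis by (simp add: L2_space_def)
qed

lemma moment_space_eq: "moment_space s v = {\<lambda>x. \<Sum>\<alpha>\<in>I. c \<alpha> * b \<alpha> x | c. True}"
  by (simp add: moment_space_def I_def n_def b_def)

lemma orth_compl_iff:
  "w \<in> orth_compl (moment_space s v) \<longleftrightarrow> w \<in> L2_space \<and> (\<forall>\<alpha>\<in>I. l2_inner (b \<alpha>) w = 0)"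
proof
  assume w: "w \<in> orth_compl (moment_space s v)"
  have "l2_inner (b \<alpha>) w = 0" if "\<alpha> \<in> I" for \<alpha>
  proof -
    have "(\<lambda>x. \<Sum>\<beta>\<in>I. (if \<alpha> = \<beta> then 1 else 0) * b \<beta> x) \<in> moment_space s v"
      unfolding moment_space_eq by (rule CollectI, rule exI[of _ "\<lambda>\<beta>. if \<alpha> = \<beta> then 1 else 0"]) simp
    moreover have "(\<lambda>x. \<Sum>\<beta>\<in>I. (if \<alpha> = \<beta> then 1 else 0) * b \<beta> x) = b \<alpha>"
    proof
      fix x
      have "(\<Sum>\<beta>\<in>I. (if \<alpha> = \<beta> then 1 else 0) * b \<beta> x) = (\<Sum>\<beta>\<in>I. if \<alpha> = \<beta> then b \<beta> x else 0)"
        by (intro sum.cong) auto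
      then show "(\<Sum>\<beta>\<in>I. (if \<alpha> = \<beta> then 1 else 0) * b \<beta> x) = b \<alpha> x"
        using that finite_I by simp
    qed
    ultimately show ?thesis using w by (simp add: orth_compl_def)
  qed
  then show "w \<in> L2_space \<and> (\<forall>\<alpha>\<in>I. l2_inner (b \<alpha>) w = 0)"
    using w by (simp add: orth_compl_def)
next
  assume w: "w \<in> L2_space \<and> (\<forall>\<alpha>\<in>I. l2_inner (b \<alpha>) w = 0)"
  have "l2_inner (\<lambda>x. \<Sum>\<alpha>\<in>I. c \<alpha> * b \<alpha> x) w = 0" for c
    using w by (subst l2_inner_sum_left) (auto simp: finite_I b_L2)
  then show "w \<in> orth_compl (moment_space s v)"
    using w unfolding orth_compl_def moment_space_eq by blast
qed

section \<open>The projection in explicit form\<close>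

definition m :: nat where "m = (SOME m. \<exists>q. orthonormalizes I b m q)"

definition q :: "nat \<Rightarrow> real^'d \<Rightarrow> complex" where "q = (SOME q. orthonormalizes I b m q)"

lemma orthonormalizes_q: "orthonormalizes I b m q"
proof -
  have "\<exists>m q. orthonormalizes I b m q" using ex_orthonormalization[OF finite_I b_L2] .
  then have "\<exists>q. orthonormalizes I b m q" unfolding m_def by (rule someI_ex)
  then show ?thesis unfolding q_def by (rule someI_ex)
qed

lemmas q_L2 = orthonormalizesD(1)[OF orthonormalizes_q]
lemmas q_orth = orthonormalizesD(2)[OF orthonormalizes_q]
lemmas q_complD = orthonormalizesD(3)[OF orthonormalizes_q]
lemmas q_complI = orthonormalizesD(4)[OF orthonormalizes_q]

lemma orth_compl_iff_q:
  "w \<in> orth_compl (moment_space s v) \<longleftrightarrow> w \<in> L2_space \<and> (\<forall>j<m. l2_inner (q j) w = 0)"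
  unfolding orth_compl_iff using q_complD q_complI by blast

text \<open>The projection onto the moment space itself, not onto its complement. Its explicit
  coefficients make the dependence on u visible, which the measurability of the kernel
  requires.\<close>

definition proj :: "(real^'d \<Rightarrow> complex) \<Rightarrow> real^'d \<Rightarrow> complex" where
  "proj u = (\<lambda>x. \<Sum>j<m. l2_inner (q j) u * q j x)"

lemma proj_L2: "proj u \<in> L2_space"
  unfolding proj_def by (intro L2_sum q_L2) auto

lemma orth_proj_part: "z \<in> orth_compl (moment_space s v) \<Longrightarrow> l2_inner z (proj u) = 0"
  unfolding proj_def orth_compl_iff_q
  by (subst l2_inner_sum) (auto simp: q_L2 l2_inner_cnj[of z])

lemma minus_proj:
  assumes "u \<in> L2_space"
  shows "(\<lambda>x. u x - proj u x) \<in> orth_compl (moment_space s v)"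
  unfolding orth_compl_iff_q
proof (intro conjI allI impI)
  show "(\<lambda>x. u x - proj u x) \<in> L2_space" by (intro L2_diff assms proj_L2)
  fix j assume j: "j < m"
  have "l2_inner (q j) (proj u) = l2_inner (q j) u"
    unfolding proj_def by (rule l2_inner_orthonormal_sum[OF q_L2 q_orth j])
  then show "l2_inner (q j) (\<lambda>x. u x - proj u x) = 0"
    using l2_inner_diff[OF q_L2[OF j] assms proj_L2] by simp
qed

text \<open>u - \<open>proj u\<close> shows that the choice in \<open>orth_proj\<close> is
  inhabited. The chosen element is determined up to null sets, so what is recorded is its membership
  and its inner products.\<close>

lemma orth_proj_props:
  fixes u :: "real^'d \<Rightarrow> complex"
  assumes "u \<in> L2_space"
  defines "w \<equiv> orth_proj (orth_compl (moment_space s v)) u"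
  shows "w \<in> orth_compl (moment_space s v)"
    and "z \<in> orth_compl (moment_space s v) \<Longrightarrow> l2_inner z w = l2_inner z u"
proof -
  let ?N = "orth_compl (moment_space s v)"
  have "\<exists>w. w \<in> ?N \<and> (\<forall>z\<in>?N. l2_inner z (\<lambda>x. u x - w x) = 0)"
    using minus_proj[OF assms(1)] orth_proj_part by (intro exI[of _ "\<lambda>x. u x - proj u x"]) simp
  then have *: "w \<in> ?N \<and> (\<forall>z\<in>?N. l2_inner z (\<lambda>x. u x - w x) = 0)"
    unfolding w_def orth_proj_def by (rule someI_ex)
  then show w: "w \<in> ?N" by blast
  assume z: "z \<in> ?N"
  have "l2_inner z (\<lambda>x. u x - w x) = 0" using * z by blast
  then show "l2_inner z w = l2_inner z u"
    using l2_inner_diff[of z u w] z w assms(1) by (simp add: orth_compl_def)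
qed

section \<open>The weighted kernel and its square integral\<close>

definition h0 :: "real^'d \<Rightarrow> real^'d \<Rightarrow> complex" where
  "h0 \<xi> = (\<lambda>x. g \<xi> x - proj (g \<xi>) x)"

lemma h0_orth: "h0 \<xi> \<in> orth_compl (moment_space s v)"
  unfolding h0_def by (intro minus_proj g_L2)

lemma h0_L2: "h0 \<xi> \<in> L2_space"
  using h0_orth by (simp add: orth_compl_def)

lemma g_inner_orth:
  assumes "w \<in> orth_compl (moment_space s v)"
  shows "l2_inner (g \<xi>) w = l2_inner (h0 \<xi>) w"
proof -
  have "w \<in> L2_space" using assms by (simp add: orth_compl_def)
  moreover have "l2_inner (proj (g \<xi>)) w = 0"
    using orth_proj_part[OF assms, of "g \<xi>"] l2_inner_cnj[of "proj (g \<xi>)" w] by simp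
  ultimately show ?thesis
    unfolding h0_def using l2_inner_diff_left[OF _ g_L2 proj_L2] by simp
qed

lemma fourier_eq:
  "fourier (\<lambda>x. complex_of_real (v x) * w x) \<xi>
    = complex_of_real ((2 * pi) powr (- (real CARD('d) / 2))) * l2_inner (g \<xi>) w"
  unfolding fourier_def l2_inner_def g_def by (simp add: cis_cnj mult.assoc)

text \<open>Square root of the frequency weight, Fourier normalization included, so that |<h, u>|^2
  is the integrand of the form. Where the denominator vanishes, division by 0 gives 0 here as in
  \<open>bs_low_form\<close>.\<close>

definition \<kappa> :: "real^'d \<Rightarrow> real" where
  "\<kappa> \<xi> = indicator (ball 0 1) \<xi> * ((2 * pi) powr (- (real CARD('d) / 2))
    * sqrt (1 / (norm \<xi> powr (2 * s) - E)))"

definition h :: "real^'d \<Rightarrow> real^'d \<Rightarrow> complex" where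
  "h \<xi> = (\<lambda>x. complex_of_real (\<kappa> \<xi>) * h0 \<xi> x)"

lemma denom_nonneg: "norm \<xi> powr (2 * s) - E \<ge> 0"
  using E_nonpos by (smt (verit) powr_ge_zero)

lemma bs_low_form_eq:
  assumes "u \<in> L2_space"
  shows "bs_low_form s v E (orth_proj (orth_compl (moment_space s v)) u)
    = (\<integral>\<^sup>+\<xi>. ennreal ((cmod (l2_inner (h \<xi>) u))\<^sup>2) \<partial>lebesgue)"
  unfolding bs_low_form_def
proof (intro nn_integral_cong)
  fix \<xi> :: "real^'d"
  let ?w = "orth_proj (orth_compl (moment_space s v)) u"
  let ?c = "(2 * pi) powr (- (real CARD('d) / 2))"
  let ?D = "norm \<xi> powr (2 * s) - E"
  have "l2_inner (g \<xi>) ?w = l2_inner (h0 \<xi>) u"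
    using g_inner_orth[OF orth_proj_props(1)[OF assms]] orth_proj_props(2)[OF assms h0_orth] by simp
  then have F: "(cmod (fourier (\<lambda>x. complex_of_real (v x) * ?w x) \<xi>))\<^sup>2
      = ?c\<^sup>2 * (cmod (l2_inner (h0 \<xi>) u))\<^sup>2"
    unfolding fourier_eq by (simp add: norm_mult power_mult_distrib)
  have "l2_inner (h \<xi>) u = of_real (\<kappa> \<xi>) * l2_inner (h0 \<xi>) u"
    using l2_inner_lin_left[OF assms h0_L2 h0_L2, of "of_real (\<kappa> \<xi>)" \<xi> 0] by (simp add: h_def)
  then have H: "(cmod (l2_inner (h \<xi>) u))\<^sup>2 = (\<kappa> \<xi>)\<^sup>2 * (cmod (l2_inner (h0 \<xi>) u))\<^sup>2"
    by (simp add: norm_mult power_mult_distrib)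
  have "(\<kappa> \<xi>)\<^sup>2 = indicator (ball 0 1) \<xi> * (?c\<^sup>2 / ?D)"
    using denom_nonneg[of \<xi>]
    by (auto simp: \<kappa>_def indicator_def power_mult_distrib real_sqrt_divide power_divide)
  then show "ennreal ((cmod (fourier (\<lambda>x. complex_of_real (v x) * ?w x) \<xi>))\<^sup>2 / ?D) * indicator (ball 0 1) \<xi>
      = ennreal ((cmod (l2_inner (h \<xi>) u))\<^sup>2)"
    unfolding F H by (auto simp: indicator_def)
qed

text \<open>\<open>proj\<close> contributes a finite sum of products of a coefficient in \<xi> and a
  fixed \<open>q j\<close> in x; the coefficients are parameter integrals of jointly measurable
  functions.\<close>

lemma h_measurable: "case_prod h \<in> borel_measurable (lebesgue \<Otimes>\<^sub>M lebesgue)"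
proof -
  have \<kappa>: "\<kappa> \<in> borel_measurable lebesgue"
  proof -
    have [measurable]: "(indicator (ball 0 1) :: real^'d \<Rightarrow> real) \<in> borel_measurable lebesgue"
      by (intro borel_measurable_indicator) simp
    show ?thesis unfolding \<kappa>_def by measurable
  qed
  have c: "(\<lambda>\<xi>. l2_inner (q j) (g \<xi>)) \<in> borel_measurable lebesgue" if "j < m" for j
  proof -
    note [measurable] = L2_measurable[OF q_L2[OF that]]
    have "(\<lambda>p. cnj (q j (snd p)) * (cis (snd p \<bullet> fst p) * complex_of_real (v (snd p))))
        \<in> borel_measurable (lebesgue \<Otimes>\<^sub>M lebesgue)"
      by measurable
    then show ?thesis
      unfolding l2_inner_def g_def by (intro leb.borel_measurable_lebesgue_integral) (simp add: case_prod_unfold)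
  qed
  have \<kappa>': "(\<lambda>\<xi>. complex_of_real (\<kappa> \<xi>)) \<in> borel_measurable lebesgue"
    using \<kappa> by measurable
  have "(\<lambda>p. complex_of_real (\<kappa> (fst p)) * (cis (snd p \<bullet> fst p) * complex_of_real (v (snd p))
      - (\<Sum>j<m. l2_inner (q j) (g (fst p)) * q j (snd p)))) \<in> borel_measurable (lebesgue \<Otimes>\<^sub>M lebesgue)"
    by (intro borel_measurable_times borel_measurable_diff borel_measurable_sum
        borel_measurable_of_real borel_measurable_plane_wave_pair
        borel_measurable_lebesgue_fst[OF \<kappa>'] borel_measurable_lebesgue_snd[OF v_measurable]
        borel_measurable_lebesgue_fst[OF c] borel_measurable_lebesgue_snd[OF L2_measurable[OF q_L2]]) auto
  then show ?thesis
    by (simp add: h_def h0_def proj_def g_def case_prod_unfold)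
qed

text \<open>
  The projection is the best approximation, so it may be replaced by the Taylor polynomial of
  \<open>exp (i x \<bullet> \<xi>)\<close>, which times \<open>v\<close> lies in the moment space.
\<close>

lemma h0_norm_bound:
  "ennreal ((l2_norm (h0 \<xi>))\<^sup>2) \<le> (\<integral>\<^sup>+x. ennreal (4 * ((japanese_bracket x * norm \<xi>) ^ (2 * n)
      * min 1 ((japanese_bracket x * norm \<xi>)\<^sup>2)) * (v x)\<^sup>2) \<partial>lebesgue)"
proof -
  let ?T = "\<lambda>x. \<Sum>k\<le>n. (\<i> * complex_of_real (x \<bullet> \<xi>)) ^ k / fact k"
  obtain c where c: "?T = (\<lambda>x. \<Sum>\<alpha>\<in>I. c \<alpha> * complex_of_real (multi_monom \<alpha> x))"
    using poly_deg_le_exp_Taylor[of n \<xi>] by (auto simp: poly_deg_le_def I_def)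
  define \<tau> where "\<tau> = (\<lambda>x. \<Sum>\<alpha>\<in>I. c \<alpha> * b \<alpha> x)"
  have \<tau>: "\<tau> x = ?T x * complex_of_real (v x)" for x
    using fun_cong[OF c, of x] by (simp add: \<tau>_def b_def sum_distrib_right mult.assoc)
  have \<tau>_L2: "\<tau> \<in> L2_space" unfolding \<tau>_def by (intro L2_sum finite_I b_L2)
  \<comment> \<open>Both parts of r are orthogonal to h0, so Pythagoras for g - \<tau> = h0 + r
    gives the best-approximation inequality.\<close>
  define r where "r = (\<lambda>x. proj (g \<xi>) x - \<tau> x)"
  have r: "r \<in> L2_space" unfolding r_def by (intro L2_diff proj_L2 \<tau>_L2)
  have "l2_inner (h0 \<xi>) \<tau> = (\<Sum>\<alpha>\<in>I. c \<alpha> * l2_inner (h0 \<xi>) (b \<alpha>))"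
    unfolding \<tau>_def by (intro l2_inner_sum h0_L2 finite_I b_L2)
  also have "\<dots> = 0"
    using h0_orth[of \<xi>] by (intro sum.neutral) (auto simp: orth_compl_iff l2_inner_cnj[of "h0 \<xi>"])
  finally have orth: "l2_inner (h0 \<xi>) r = 0"
    unfolding r_def using l2_inner_diff[OF h0_L2 proj_L2 \<tau>_L2] orth_proj_part[OF h0_orth] by simp
  have eq: "(\<lambda>x. 1 * h0 \<xi> x + 1 * r x) = (\<lambda>x. g \<xi> x - \<tau> x)"
    by (simp add: h0_def r_def)
  have "(l2_norm (h0 \<xi>))\<^sup>2 \<le> (l2_norm (\<lambda>x. g \<xi> x - \<tau> x))\<^sup>2"
    using l2_norm_square_add[OF h0_L2 r, of \<xi> 1] orth unfolding eq by simp
  then have "ennreal ((l2_norm (h0 \<xi>))\<^sup>2) \<le> ennreal ((l2_norm (\<lambda>x. g \<xi> x - \<tau> x))\<^sup>2)"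
    by (rule ennreal_leI)
  also have "\<dots> = (\<integral>\<^sup>+x. ennreal ((cmod (g \<xi> x - \<tau> x))\<^sup>2) \<partial>lebesgue)"
    by (intro l2_norm_square_nn L2_diff g_L2 \<tau>_L2)
  also have "\<dots> \<le> (\<integral>\<^sup>+x. ennreal (4 * ((japanese_bracket x * norm \<xi>) ^ (2 * n)
      * min 1 ((japanese_bracket x * norm \<xi>)\<^sup>2)) * (v x)\<^sup>2) \<partial>lebesgue)"
  proof (intro nn_integral_mono ennreal_leI)
    fix x
    have "\<bar>x \<bullet> \<xi>\<bar> \<le> norm x * norm \<xi>" by (rule Cauchy_Schwarz_ineq2)
    also have "\<dots> \<le> japanese_bracket x * norm \<xi>"
      by (intro mult_right_mono japanese_bracket_ge) auto
    finally have t: "\<bar>x \<bullet> \<xi>\<bar> \<le> japanese_bracket x * norm \<xi>" .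
    have t2: "(x \<bullet> \<xi>)\<^sup>2 \<le> (japanese_bracket x * norm \<xi>)\<^sup>2"
      using power_mono[OF t, of 2] by simp
    have "(cmod (g \<xi> x - \<tau> x))\<^sup>2 = (cmod (cis (x \<bullet> \<xi>) - ?T x))\<^sup>2 * (v x)\<^sup>2"
      unfolding \<tau> g_def by (simp add: norm_mult power_mult_distrib flip: left_diff_distrib)
    also have "\<dots> \<le> 4 * (\<bar>x \<bullet> \<xi>\<bar> ^ (2 * n) * min 1 ((x \<bullet> \<xi>)\<^sup>2)) * (v x)\<^sup>2"
      by (intro mult_right_mono exp_Taylor_remainder) auto
    also have "\<dots> \<le> 4 * ((japanese_bracket x * norm \<xi>) ^ (2 * n)
      * min 1 ((japanese_bracket x * norm \<xi>)\<^sup>2)) * (v x)\<^sup>2"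
      using power_mono[OF t, of "2 * n"] min.mono[OF order_refl t2, of 1] japanese_bracket_ge(1)[of x]
      by (intro mult_right_mono mult_left_mono mult_mono) auto
    finally show "(cmod (g \<xi> x - \<tau> x))\<^sup>2 \<le> 4 * ((japanese_bracket x * norm \<xi>) ^ (2 * n)
      * min 1 ((japanese_bracket x * norm \<xi>)\<^sup>2)) * (v x)\<^sup>2" .
  qed
  finally show ?thesis .
qed

text \<open>E \<le> 0 can only enlarge the denominator, and (2 pi)^(-d) \<le> 1. At \<xi> = 0 the
  claim would fail for E < 0, since \<open>0 powr _ = 0\<close> on the right.\<close>

lemma \<kappa>_square_le:
  assumes "\<xi> \<noteq> 0"
  shows "(\<kappa> \<xi>)\<^sup>2 \<le> indicator (ball 0 1) \<xi> * norm \<xi> powr (- 2 * s)"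
proof -
  let ?c = "(2 * pi) powr (- (real CARD('d) / 2))"
  have pos: "norm \<xi> powr (2 * s) > 0" using assms by simp
  then have D: "norm \<xi> powr (2 * s) - E > 0" using E_nonpos by linarith
  have "?c \<le> (2 * pi) powr 0" using pi_gt3 by (intro powr_mono) auto
  then have c: "?c\<^sup>2 \<le> 1" using pi_gt3 by (simp add: abs_square_le_1)
  have "(\<kappa> \<xi>)\<^sup>2 = indicator (ball 0 1) \<xi> * (?c\<^sup>2 * (1 / (norm \<xi> powr (2 * s) - E)))"
    using denom_nonneg[of \<xi>]
    by (auto simp: \<kappa>_def indicator_def power_mult_distrib real_sqrt_divide power_divide)
  also have "\<dots> \<le> indicator (ball 0 1) \<xi> * (1 * (1 / norm \<xi> powr (2 * s)))"
    using c pos E_nonpos D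
    by (intro mult_left_mono mult_mono divide_left_mono) auto
  also have "1 * (1 / norm \<xi> powr (2 * s)) = norm \<xi> powr (- 2 * s)"
    by (simp add: powr_minus divide_inverse)
  finally show ?thesis .
qed

text \<open>Tonelli moves the frequency integral inside, where for fixed x the hypothesis on C
  applies with L = <x>; the 4 is that of the Taylor remainder. C enters as a hypothesis so that it
  can be chosen before E and v.\<close>

lemma kernel_bound:
  assumes C: "C > 0" "\<And>L. L \<ge> 1 \<Longrightarrow> (\<integral>\<^sup>+\<xi>\<in>ball (0 :: real^'d) 1. ennreal (norm \<xi> powr (- 2 * s) * (L * norm \<xi>) ^ (2 * n)
        * min 1 ((L * norm \<xi>)\<^sup>2)) \<partial>lebesgue)
      \<le> ennreal (C * (L powr (2 * s - real CARD('d))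
          * (if s - real CARD('d) / 2 = real n then 1 + ln L else 1)))"
  shows "(\<integral>\<^sup>+\<xi>. \<integral>\<^sup>+x. ennreal ((cmod (h \<xi> x))\<^sup>2) \<partial>lebesgue \<partial>lebesgue)
    \<le> ennreal (4 * C * (l2_norm (\<lambda>x. complex_of_real (bs_weight s x * v x)))\<^sup>2)"
proof -
  let ?L = japanese_bracket
  define F where "F = (\<lambda>(\<xi> :: real^'d) (x :: real^'d). norm \<xi> powr (- 2 * s) * (?L x * norm \<xi>) ^ (2 * n)
        * min 1 ((?L x * norm \<xi>)\<^sup>2))"
  have F0: "F \<xi> x \<ge> 0" for \<xi> x
    using japanese_bracket_ge(1)[of x] by (simp add: F_def)
  have B: "(\<lambda>\<xi>. indicator (ball (0 :: real^'d) 1) \<xi> :: ennreal) \<in> borel_measurable lebesgue"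
    by (intro borel_measurable_indicator) simp
  have FP: "(\<lambda>p. F (fst p) (snd p)) \<in> borel_measurable (lebesgue \<Otimes>\<^sub>M lebesgue)"
    unfolding F_def by measurable
  have "(\<lambda>p. ennreal (4 * (v (snd p))\<^sup>2) * (ennreal (F (fst p) (snd p)) * indicator (ball 0 1) (fst p)))
      \<in> borel_measurable (lebesgue \<Otimes>\<^sub>M lebesgue)"
    by (intro borel_measurable_times_ennreal measurable_compose[OF FP measurable_ennreal]
        measurable_compose[OF _ measurable_ennreal]
        borel_measurable_lebesgue_fst[OF B] borel_measurable_times borel_measurable_power
        borel_measurable_lebesgue_snd[OF v_measurable] borel_measurable_const)
  then have Fm: "(\<lambda>(\<xi>, x). ennreal (4 * (v x)\<^sup>2) * (ennreal (F \<xi> x) * indicator (ball 0 1) \<xi>))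
      \<in> borel_measurable (lebesgue \<Otimes>\<^sub>M lebesgue)"
    by (simp add: case_prod_unfold)
  \<comment> \<open>The pointwise bound on \<kappa> excludes the origin, a null set.\<close>
  have AE0: "AE \<xi> in lebesgue. \<xi> \<noteq> (0 :: real^'d)"
    by (rule AE_I'[of "{0}"]) (auto simp flip: negligible_iff_null_sets)
  have "(\<integral>\<^sup>+\<xi>. \<integral>\<^sup>+x. ennreal ((cmod (h \<xi> x))\<^sup>2) \<partial>lebesgue \<partial>lebesgue)
      \<le> (\<integral>\<^sup>+\<xi>. \<integral>\<^sup>+x. ennreal (4 * (v x)\<^sup>2) * (ennreal (F \<xi> x) * indicator (ball 0 1) \<xi>) \<partial>lebesgue \<partial>lebesgue)"
  proof (rule nn_integral_mono_AE, use AE0 in eventually_elim)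
    fix \<xi> :: "real^'d" assume xi: "\<xi> \<noteq> 0"
    have [measurable]: "h0 \<xi> \<in> borel_measurable lebesgue" using h0_L2 by (rule L2_measurable)
    have "(\<integral>\<^sup>+x. ennreal ((cmod (h \<xi> x))\<^sup>2) \<partial>lebesgue)
        = (\<integral>\<^sup>+x. ennreal ((\<kappa> \<xi>)\<^sup>2) * ennreal ((cmod (h0 \<xi> x))\<^sup>2) \<partial>lebesgue)"
      by (simp add: h_def norm_mult power_mult_distrib ennreal_mult)
    also have "\<dots> = ennreal ((\<kappa> \<xi>)\<^sup>2) * ennreal ((l2_norm (h0 \<xi>))\<^sup>2)"
      unfolding l2_norm_square_nn[OF h0_L2] by (rule nn_integral_cmult) measurable
    also have "\<dots> \<le> ennreal (indicator (ball 0 1) \<xi> * norm \<xi> powr (- 2 * s))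
        * (\<integral>\<^sup>+x. ennreal (4 * ((?L x * norm \<xi>) ^ (2 * n) * min 1 ((?L x * norm \<xi>)\<^sup>2)) * (v x)\<^sup>2) \<partial>lebesgue)"
      by (intro mult_mono ennreal_leI \<kappa>_square_le xi h0_norm_bound) auto
    also have "\<dots> = (\<integral>\<^sup>+x. ennreal (indicator (ball 0 1) \<xi> * norm \<xi> powr (- 2 * s))
        * ennreal (4 * ((?L x * norm \<xi>) ^ (2 * n) * min 1 ((?L x * norm \<xi>)\<^sup>2)) * (v x)\<^sup>2) \<partial>lebesgue)"
      by (rule nn_integral_cmult[symmetric]) measurable
    also have "\<dots> = (\<integral>\<^sup>+x. ennreal (4 * (v x)\<^sup>2) * (ennreal (F \<xi> x) * indicator (ball 0 1) \<xi>) \<partial>lebesgue)"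
    proof (intro nn_integral_cong)
      fix x
      show "ennreal (indicator (ball 0 1) \<xi> * norm \<xi> powr (- 2 * s))
          * ennreal (4 * ((?L x * norm \<xi>) ^ (2 * n) * min 1 ((?L x * norm \<xi>)\<^sup>2)) * (v x)\<^sup>2)
          = ennreal (4 * (v x)\<^sup>2) * (ennreal (F \<xi> x) * indicator (ball 0 1) \<xi>)"
        using F0[of \<xi> x]
        by (cases "\<xi> \<in> ball 0 1") (auto simp: F_def ennreal_mult'[symmetric] ennreal_mult''[symmetric] mult_ac)
    qed
    finally show "(\<integral>\<^sup>+x. ennreal ((cmod (h \<xi> x))\<^sup>2) \<partial>lebesgue)
        \<le> (\<integral>\<^sup>+x. ennreal (4 * (v x)\<^sup>2) * (ennreal (F \<xi> x) * indicator (ball 0 1) \<xi>) \<partial>lebesgue)" .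
  qed
  also have "\<dots> = (\<integral>\<^sup>+x. \<integral>\<^sup>+\<xi>. ennreal (4 * (v x)\<^sup>2) * (ennreal (F \<xi> x) * indicator (ball 0 1) \<xi>) \<partial>lebesgue \<partial>lebesgue)"
    by (rule leb_pair.Fubini'[symmetric, OF Fm])
  also have "\<dots> \<le> (\<integral>\<^sup>+x. ennreal (4 * C) * ennreal ((cmod (complex_of_real (bs_weight s x * v x)))\<^sup>2) \<partial>lebesgue)"
  proof (intro nn_integral_mono)
    fix x :: "real^'d"
    have "(\<lambda>\<xi>. F \<xi> x) \<in> borel_measurable lebesgue"
      unfolding F_def by measurable
    then have Fx: "(\<lambda>\<xi>. ennreal (F \<xi> x) * indicator (ball 0 1) \<xi>) \<in> borel_measurable lebesgue"
      by (intro borel_measurable_times_ennreal B measurable_compose[OF _ measurable_ennreal])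
    have "(\<integral>\<^sup>+\<xi>. ennreal (4 * (v x)\<^sup>2) * (ennreal (F \<xi> x) * indicator (ball 0 1) \<xi>) \<partial>lebesgue)
        = ennreal (4 * (v x)\<^sup>2) * (\<integral>\<^sup>+\<xi>\<in>ball 0 1. ennreal (F \<xi> x) \<partial>lebesgue)"
      by (rule nn_integral_cmult[OF Fx])
    also have "\<dots> \<le> ennreal (4 * (v x)\<^sup>2) * ennreal (C * (bs_weight s x)\<^sup>2)"
      unfolding F_def weight_square by (intro mult_left_mono C japanese_bracket_ge) auto
    also have "\<dots> = ennreal (4 * C) * ennreal ((cmod (complex_of_real (bs_weight s x * v x)))\<^sup>2)"
      unfolding norm_of_real power2_abs using C(1)
      by (simp add: ennreal_mult[symmetric] power_mult_distrib mult_ac)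
    finally show "(\<integral>\<^sup>+\<xi>. ennreal (4 * (v x)\<^sup>2) * (ennreal (F \<xi> x) * indicator (ball 0 1) \<xi>) \<partial>lebesgue)
        \<le> ennreal (4 * C) * ennreal ((cmod (complex_of_real (bs_weight s x * v x)))\<^sup>2)" .
  qed
  also have "\<dots> = ennreal (4 * C) * ennreal ((l2_norm (\<lambda>x. complex_of_real (bs_weight s x * v x)))\<^sup>2)"
    unfolding l2_norm_square_nn[OF weighted_L2]
    by (rule nn_integral_cmult, rule measurable_compose[OF L2_measurable[OF weighted_L2]]) measurable
  also have "\<dots> = ennreal (4 * C * (l2_norm (\<lambda>x. complex_of_real (bs_weight s x * v x)))\<^sup>2)"
    using C(1) by (simp add: ennreal_mult)
  finally show ?thesis .
qed

end

text \<open>The existence clause keeps the bound over all K from being vacuous. An arbitrary K can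
  be treated because its form determines the diagonal elements that the trace sums.\<close>

theorem theorem1p6:
  fixes s :: real
  assumes "s \<ge> real CARD('d::finite) / 2"
  shows "\<exists>C>0. \<forall>E\<le>0. \<forall>v :: real^'d \<Rightarrow> real.
    v \<in> borel_measurable lebesgue \<longrightarrow> (\<forall>x. 0 \<le> v x) \<longrightarrow>
    (\<lambda>x. complex_of_real (bs_weight s x * v x)) \<in> L2_space \<longrightarrow>
      (\<exists>K. is_bs_low_perp s v E K) \<and>
      (\<forall>K. is_bs_low_perp s v E K \<longrightarrow>
         trace_norm K \<le> ennreal (C * (l2_norm (\<lambda>x. complex_of_real (bs_weight s x * v x)))\<^sup>2))"
proof -
  \<comment> \<open>The degree depends on s and d alone, so C is obtained before E and v are fixed;
    inside the locale the degree reappears as n.\<close>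
  define N where "N = nat \<lfloor>s - real CARD('d) / 2\<rfloor>"
  have N: "real N \<le> s - real CARD('d) / 2" "s - real CARD('d) / 2 < real N + 1"
    using assms unfolding N_def by (simp, linarith)
  obtain C where C: "C > 0"
    "\<And>L. L \<ge> 1 \<Longrightarrow> (\<integral>\<^sup>+\<xi>\<in>ball (0 :: real^'d) 1. ennreal (norm \<xi> powr (- 2 * s) * (L * norm \<xi>) ^ (2 * N)
        * min 1 ((L * norm \<xi>)\<^sup>2)) \<partial>lebesgue)
      \<le> ennreal (C * (L powr (2 * s - real CARD('d))
          * (if s - real CARD('d) / 2 = real N then 1 + ln L else 1)))"
    using low_frequency_integral_bound[OF N] by blast
  show ?thesis
  proof (rule exI[of _ "4 * C"], intro conjI allI impI)
    show "4 * C > 0" using C(1) by simp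
    fix E :: real and v :: "real^'d \<Rightarrow> real"
    assume "E \<le> 0" "v \<in> borel_measurable lebesgue" "\<forall>x. 0 \<le> v x"
      "(\<lambda>x. complex_of_real (bs_weight s x * v x)) \<in> L2_space"
    then interpret bs_low s E v
      using assms by unfold_locales auto
    let ?R = "4 * C * (l2_norm (\<lambda>x. complex_of_real (bs_weight s x * v x)))\<^sup>2"
    have bound: "(\<integral>\<^sup>+\<xi>. \<integral>\<^sup>+x. ennreal ((cmod (h \<xi> x))\<^sup>2) \<partial>lebesgue \<partial>lebesgue) \<le> ennreal ?R"
      by (rule kernel_bound[OF C(1)]) (unfold n_def, fold N_def, rule C(2))
    interpret hs_kernel h
    proof
      show "case_prod h \<in> borel_measurable (lebesgue \<Otimes>\<^sub>M lebesgue)" by (rule h_measurable)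
      show "h \<xi> \<in> L2_space" for \<xi> unfolding h_def by (intro L2_cmult h0_L2)
      show "(\<integral>\<^sup>+\<xi>. \<integral>\<^sup>+x. ennreal ((cmod (h \<xi> x))\<^sup>2) \<partial>lebesgue \<partial>lebesgue) < \<infinity>"
        using bound by (simp add: le_less_trans)
    qed
    show "\<exists>K. is_bs_low_perp s v E K"
      unfolding is_bs_low_perp_def
      using frame_op_nonneg frame_op_form bs_low_form_eq by auto
    fix K assume "is_bs_low_perp s v E K"
    then have K: "nonneg_op K" and form: "\<And>u. u \<in> L2_space \<Longrightarrow>
        ennreal (Re (l2_inner u (K u))) = (\<integral>\<^sup>+\<xi>. ennreal ((cmod (l2_inner (h \<xi>) u))\<^sup>2) \<partial>lebesgue)"
      using bs_low_form_eq by (auto simp: is_bs_low_perp_def)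
    show "trace_norm K \<le> ennreal ?R"
      unfolding trace_norm_def
    proof (rule SUP_least)
      fix e :: "nat \<Rightarrow> real^'d \<Rightarrow> complex" assume "e \<in> Collect orthonormal_basis"
      then have e: "orthonormal_basis e" by simp
      then have eL: "e k \<in> L2_space" for k by (simp add: orthonormal_basis_def)
      \<comment> \<open>Here \<open>op_abs\<close> disappears, and the diagonal elements become
        those prescribed by the form.\<close>
      have "(\<Sum>k. ennreal (Re (l2_inner (e k) (op_abs K (e k)))))
          = (\<Sum>k. \<integral>\<^sup>+\<xi>. ennreal ((cmod (l2_inner (h \<xi>) (e k)))\<^sup>2) \<partial>lebesgue)"
        by (simp add: l2_inner_op_abs[OF K eL eL] form[OF eL])
      also have "\<dots> \<le> ennreal hs_trace" by (rule trace_sum_bound[OF e])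
      also have "\<dots> \<le> ennreal ?R" using bound by (simp only: hs_trace_eq)
      finally show "(\<Sum>k. ennreal (Re (l2_inner (e k) (op_abs K (e k))))) \<le> ennreal ?R" .
    qed
  qed
qed

end
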